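(* Let $A \geqslant 1$ and let $\alpha,\beta\in\mathbb{R}$ with $\alpha>1$, where $\alpha$ is irrational and of finite type. Then for every $f\in\mathscr{F}_A$ and every integer $N\geqslant 3$, $$ \sum_{\substack{n \leqslant N\\ n \in \mathcal{B}_{\alpha,\beta}}} f(n)=\alpha^{-1}\sum_{n\leqslant N} f(n)+O\!\left(\frac{N\log\log N}{\log N}\right), $$ where the implied constant depends only on $\alpha$ and $A$.
   Context: For $A\geqslant 1$, $\mathscr{F}_A$ denotes the set of (complex-valued) multiplicative functions $f$ such that $|f(p)|\leqslant A$ for all primes $p$ and $\sum_{n\leqslant N}|f(n)|^2\leqslant A^2N$ for all $N\in\mathbb{N}$. The non-homogeneous Beatty sequence is $\mathcal{B}_{\alpha,\beta}=\{n\in\mathbb{N} : n=\lfloor \alpha m+\beta\rfloor \text{ for some } m\in\mathbb{Z}\}$. For an irrational number $\gamma$, its type is $\tau=\sup\{t\in\mathbb{R} : \liminf_{n\to\infty} n^t \|\gamma n\| = 0\}$, where $\|x\|$ denotes the distance from $x$ to the nearest integer; $\gamma$ is of finite type if $\tau<\infty$. *)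

theory Defs
  imports "HOL-Analysis.Analysis"
begin

definition multiplicative_fun :: "(nat \<Rightarrow> complex) \<Rightarrow> bool" where
  "multiplicative_fun f \<longleftrightarrow> f 1 = 1 \<and>
     (\<forall>m n. coprime m n \<longrightarrow> f (m * n) = f m * f n)"

definition FA :: "real \<Rightarrow> (nat \<Rightarrow> complex) set" where
  "FA A = {f. multiplicative_fun f \<and> (\<forall>p. prime p \<longrightarrow> cmod (f p) \<le> A) \<and>
      (\<forall>N. (\<Sum>n=1..N. (cmod (f n))^2) \<le> A^2 * real N)}"

definition beatty :: "real \<Rightarrow> real \<Rightarrow> nat set" where
  "beatty \<alpha> \<beta> = {n. n \<ge> 1 \<and> (\<exists>m::int. int n = \<lfloor>\<alpha> * of_int m + \<beta>\<rfloor>)}"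

definition dist_nint :: "real \<Rightarrow> real" where
  "dist_nint x = \<bar>x - of_int (round x)\<bar>"

definition irr_type :: "real \<Rightarrow> ereal" where
  "irr_type \<gamma> = Sup (ereal ` {t::real.
      liminf (\<lambda>n::nat. ereal (real n powr t * dist_nint (\<gamma> * real n))) = 0})"

definition finite_type :: "real \<Rightarrow> bool" where
  "finite_type \<gamma> \<longleftrightarrow> irr_type \<gamma> < \<infinity>"

end

theory Submission
  imports Defs "HOL-Computational_Algebra.Squarefree"
begin

text \<open>
  Write \<open>\<theta> = 1 / \<alpha>\<close>. Membership of \<open>n\<close> in the Beatty sequence, minus its density \<open>\<theta>\<close>, is a
  difference of two sawtooth values at points of a rotation by \<open>\<theta>\<close>. Replace the sawtooth by its
  Fourier partial sum of length \<open>K\<close>, a fixed power of \<open>ln N\<close>; by finite type few points of the rotation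
  come close to an integer, so by Cauchy--Schwarz the truncation costs \<open>O(N / (ln N)\<^sup>2)\<close>.

  For the remaining bounded trigonometric polynomial \<open>g\<close>, multiply \<open>\<Sum> f n * g n\<close> by \<open>ln N\<close> and use
  \<open>ln N = ln (N / n) + ln n\<close>. The first part contributes \<open>O(N)\<close>; splitting \<open>ln n\<close> over the prime
  factors of \<open>n\<close> reduces the second, up to \<open>O(N)\<close>, to the sum of \<open>ln p * f p * f m * g (p * m)\<close> over
  \<open>p * m \<le> N\<close>. The ranges where \<open>p\<close> or \<open>m\<close> is at most a power of \<open>ln N\<close> contribute
  \<open>O(N * ln (ln N))\<close> by Chebyshev's bound, using only that \<open>g\<close> is bounded. In the remaining range each
  frequency of \<open>g\<close> contributes \<open>O(N)\<close> by Cauchy--Schwarz over dyadic blocks of \<open>p\<close>, where finite type saves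
  an arbitrary power of \<open>ln N\<close>; the Fourier coefficients sum to \<open>O(ln K) = O(ln (ln N))\<close>.
\<close>
subsection \<open>Distance to the nearest integer and finite type\<close>

lemma dist_nint_le: "dist_nint x \<le> \<bar>x - of_int k\<bar>"
  unfolding dist_nint_def by (rule round_diff_minimal)

lemma dist_nint_nonneg: "0 \<le> dist_nint x"
  by (simp add: dist_nint_def)

lemma dist_nint_diff: "dist_nint (x - y) \<le> dist_nint x + dist_nint y"
proof -
  have "dist_nint (x - y) \<le> \<bar>(x - y) - of_int (round x - round y)\<bar>"
    by (rule dist_nint_le)
  also have "\<dots> \<le> dist_nint x + dist_nint y"
    unfolding dist_nint_def by simp
  finally show ?thesis .
qed

lemma dist_nint_minus: "dist_nint (- x) = dist_nint x"
proof -
  have "dist_nint (- y) \<le> dist_nint y" for y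
    using dist_nint_le[of "- y" "- round y"] by (simp add: dist_nint_def abs_minus_commute)
  from this[of x] this[of "- x"] show ?thesis by simp
qed

text \<open>A natural number \<open>t\<close> above the type lies outside the set whose supremum is
  the type, so the liminf with exponent \<open>t\<close>, being nonnegative and nonzero, is
  positive. This handles all large \<open>k\<close>; irrationality keeps the finitely many remaining
  distances positive.\<close>

lemma finite_type_bound:
  assumes "finite_type \<alpha>" and "\<alpha> \<notin> \<rat>"
  obtains c :: real and t :: nat where "c > 0"
    and "\<And>k. k \<ge> 1 \<Longrightarrow> c / real k ^ t \<le> dist_nint (\<alpha> * real k)"
proof -
  from assms(1) obtain t :: nat where t: "irr_type \<alpha> < ereal (real t)"
    unfolding finite_type_def using less_PInf_Ex_of_nat by auto
  define u where "u = (\<lambda>n::nat. ereal (real n powr real t * dist_nint (\<alpha> * real n)))"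
  have "liminf u \<noteq> 0"
  proof
    assume "liminf u = 0"
    hence "ereal (real t) \<le> irr_type \<alpha>"
      unfolding irr_type_def u_def by (intro Sup_upper) auto
    with t show False by simp
  qed
  moreover have "0 \<le> liminf u"
    by (intro Liminf_bounded always_eventually) (auto simp: u_def dist_nint_nonneg)
  ultimately have "0 < liminf u" by simp
  then obtain y where y: "0 < ereal y" "ereal y < liminf u"
    using ereal_dense2 by blast
  from y(2) have "eventually (\<lambda>n. ereal y < u n) sequentially"
    by (rule less_LiminfD)
  then obtain n0 where n0: "\<And>n. n \<ge> n0 \<Longrightarrow> ereal y < u n"
    by (auto simp: eventually_sequentially)
  have pos: "0 < dist_nint (\<alpha> * real k)" if "k \<ge> 1" for k
  proof (rule ccontr)
    assume "\<not> ?thesis"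
    hence "\<alpha> * real k = of_int (round (\<alpha> * real k))"
      using dist_nint_nonneg[of "\<alpha> * real k"] unfolding dist_nint_def by linarith
    hence "\<alpha> = of_int (round (\<alpha> * real k)) / of_nat k"
      using that by (simp add: field_simps)
    also have "\<dots> \<in> \<rat>" by auto
    finally show False using assms(2) by simp
  qed
  \<comment> \<open>Since \<open>k ^ t\<close> is at least 1, one minimum serves the small
    \<open>k\<close> directly and the tail through \<open>y\<close>.\<close>
  define c where "c = Min (insert y ((\<lambda>k. dist_nint (\<alpha> * real k)) ` {1..n0}))"
  have "c > 0" unfolding c_def using pos y(1) by auto
  moreover have "c / real k ^ t \<le> dist_nint (\<alpha> * real k)" if k: "k \<ge> 1" for k
  proof (cases "k \<le> n0")
    case True
    have "c / real k ^ t \<le> c"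
      using k \<open>c > 0\<close> by (simp add: divide_le_eq one_le_power)
    also have "c \<le> dist_nint (\<alpha> * real k)"
      unfolding c_def using True k by (intro Min_le) auto
    finally show ?thesis .
  next
    case False
    have "c \<le> y" unfolding c_def by (intro Min_le) auto
    also have "y < real k ^ t * dist_nint (\<alpha> * real k)"
      using n0[of k] False k by (simp add: u_def powr_realpow)
    finally show ?thesis using k by (simp add: field_simps)
  qed
  ultimately show ?thesis by (rule that)
qed

text \<open>The Beatty condition rotates by \<open>1 / \<alpha>\<close>, so the bound is transferred
  from \<alpha>. If \<open>m\<close> is the integer nearest to \<open>k / \<alpha>\<close>, then
  \<open>\<alpha> * \<bar>k / \<alpha> - m\<bar> = \<bar>k - \<alpha> * m\<bar>\<close>, which is
  bounded below by the distance of \<open>\<alpha> * m\<close> to the integers.\<close>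

lemma finite_type_inverse_bound:
  fixes \<alpha> :: real
  assumes "finite_type \<alpha>" and "\<alpha> \<notin> \<rat>" and "\<alpha> > 1"
  obtains c :: real and t :: nat where "c > 0"
    and "\<And>k. k \<ge> 1 \<Longrightarrow> c / real k ^ t \<le> dist_nint (real k * (1 / \<alpha>))"
proof -
  obtain c t where c: "c > 0"
    and dist: "\<And>k. k \<ge> 1 \<Longrightarrow> c / real k ^ t \<le> dist_nint (\<alpha> * real k)"
    using finite_type_bound[OF assms(1,2)] by blast
  \<comment> \<open>The first entry serves \<open>m = 0\<close>, where the bound for \<alpha> says
    nothing; the second pays for the factor \<alpha> and for an index \<open>m\<close> as large as
    \<open>2 * k\<close>.\<close>
  define c' where "c' = min (1 / \<alpha>) (c / (2 ^ t * \<alpha>))"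
  have "c' > 0" using c assms(3) by (simp add: c'_def)
  moreover have "c' / real k ^ t \<le> dist_nint (real k * (1 / \<alpha>))" if k: "k \<ge> 1" for k
  proof -
    define m where "m = round (real k * (1 / \<alpha>))"
    have d: "dist_nint (real k * (1 / \<alpha>)) = \<bar>real k / \<alpha> - of_int m\<bar>"
      by (simp add: dist_nint_def m_def)
    have "m \<ge> 0"
      using round_mono[of 0 "real k * (1 / \<alpha>)"] assms(3) by (simp add: m_def)
    have kt: "1 \<le> real k ^ t" using k by simp
    show ?thesis
    proof (cases "m = 0")
      case True
      have "c' / real k ^ t \<le> c'" using kt \<open>c' > 0\<close> by (simp add: divide_le_eq)
      also have "\<dots> \<le> 1 / \<alpha>" by (simp add: c'_def)
      also have "\<dots> \<le> real k / \<alpha>" using k assms(3) by (simp add: divide_right_mono)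
      finally show ?thesis using d True assms(3) by simp
    next
      case False
      define j where "j = nat m"
      have j: "j \<ge> 1" "of_int m = real j" using False \<open>m \<ge> 0\<close> by (auto simp: j_def)
      have "of_int m \<le> real k * (1 / \<alpha>) + 1 / 2"
        unfolding m_def by (rule of_int_round_le)
      also have "real k * (1 / \<alpha>) \<le> real k"
        using assms(3) mult_left_mono[of 1 \<alpha> "real k"] by (simp add: divide_le_eq)
      also have "real k + 1 / 2 \<le> 2 * real k" using k by simp
      finally have jk: "real j \<le> 2 * real k" using j by simp
      have "c / (2 * real k) ^ t \<le> c / real j ^ t"
        using c j jk by (intro divide_left_mono power_mono) auto
      also have "\<dots> \<le> dist_nint (\<alpha> * real j)" by (rule dist[OF j(1)])
      also have "\<dots> \<le> \<bar>\<alpha> * real j - of_int (int k)\<bar>" by (rule dist_nint_le)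
      also have "\<dots> = \<alpha> * \<bar>real k / \<alpha> - real j\<bar>"
      proof -
        have "\<alpha> * \<bar>real k / \<alpha> - real j\<bar> = \<bar>\<alpha> * (real k / \<alpha> - real j)\<bar>"
          using assms(3) by (simp add: abs_mult)
        also have "\<alpha> * (real k / \<alpha> - real j) = real k - \<alpha> * real j"
          using assms(3) by (simp add: field_simps)
        finally show ?thesis by simp
      qed
      finally have "c / (2 ^ t * \<alpha>) / real k ^ t \<le> \<bar>real k / \<alpha> - real j\<bar>"
        using assms(3) k by (simp add: field_simps)
      moreover have "c' / real k ^ t \<le> c / (2 ^ t * \<alpha>) / real k ^ t"
        using kt by (intro divide_right_mono) (auto simp: c'_def)
      ultimately show ?thesis using d j by simp
    qed
  qed
  ultimately show ?thesis by (rule that)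
qed

section \<open>Points of a rotation close to the integers\<close>

text \<open>Cut the window into blocks of length \<open>L\<close>: separation makes the block number
  injective on \<open>S\<close>, and at most \<open>n div L + 1\<close> block numbers occur.\<close>

lemma card_separated_le:
  fixes S :: "nat set"
  assumes sep: "\<And>i j. i \<in> S \<Longrightarrow> j \<in> S \<Longrightarrow> i < j \<Longrightarrow> L \<le> j - i" and "L \<ge> 1"
  shows "card (S \<inter> {a<..a + n}) \<le> n div L + 1"
proof -
  have "inj_on (\<lambda>i. (i - a - 1) div L) (S \<inter> {a<..a + n})"
  proof (rule linorder_inj_onI)
    fix i j assume ij: "i < j" "i \<in> S \<inter> {a<..a + n}" "j \<in> S \<inter> {a<..a + n}"
    hence "i - a - 1 + L \<le> j - a - 1" using sep[of i j] by auto
    hence "(i - a - 1 + L) div L \<le> (j - a - 1) div L" by (rule div_le_mono)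
    thus "(i - a - 1) div L \<noteq> (j - a - 1) div L" using assms(2) by simp
  qed auto
  moreover have "(\<lambda>i. (i - a - 1) div L) ` (S \<inter> {a<..a + n}) \<subseteq> {0..n div L}"
    by (auto intro!: div_le_mono)
  ultimately have "card (S \<inter> {a<..a + n}) \<le> card {0..n div L}"
    by (intro card_inj_on_le) auto
  thus ?thesis by simp
qed

text \<open>Two terms of a rotation by \<open>\<omega>\<close> whose indices differ by less than \<open>L\<close> cannot both be
  closer than \<open>\<delta> / 2\<close> to an integer.\<close>

lemma sum_rotation_le:
  fixes F :: "nat \<Rightarrow> real" and \<omega> y \<delta> B b :: real
  assumes sep: "\<And>h. 1 \<le> h \<Longrightarrow> h < L \<Longrightarrow> \<delta> \<le> dist_nint (real h * \<omega>)" and "L \<ge> 1"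
    and near: "\<And>i. F i \<le> B" and "B \<ge> 0" and "b \<ge> 0"
    and far: "\<And>i. \<delta> / 2 \<le> dist_nint (y + real i * \<omega>) \<Longrightarrow> F i \<le> b"
  shows "(\<Sum>i\<in>{a<..a + n}. F i) \<le> B * (real n / real L + 1) + real n * b"
proof -
  define S where "S = {i. dist_nint (y + real i * \<omega>) < \<delta> / 2}"
  have "card (S \<inter> {a<..a + n}) \<le> n div L + 1"
  proof (rule card_separated_le)
    fix i j assume ij: "i \<in> S" "j \<in> S" "i < j"
    have "dist_nint (real (j - i) * \<omega>) = dist_nint ((y + real j * \<omega>) - (y + real i * \<omega>))"
      using ij(3) by (simp add: of_nat_diff algebra_simps)
    also have "\<dots> \<le> dist_nint (y + real j * \<omega>) + dist_nint (y + real i * \<omega>)"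
      by (rule dist_nint_diff)
    also have "\<dots> < \<delta>" using ij(1,2) by (simp add: S_def)
    finally show "L \<le> j - i" using sep[of "j - i"] ij(3) by (cases "j - i < L") (auto simp: Suc_le_eq simp flip: of_nat_diff)
  qed fact
  hence "real (card (S \<inter> {a<..a + n})) \<le> real (n div L) + 1" by linarith
  also have "real (n div L) \<le> real n / real L" by (rule of_nat_div_le_of_nat)
  finally have card: "real (card (S \<inter> {a<..a + n})) \<le> real n / real L + 1" by simp
  \<comment> \<open>Near indices are charged \<open>B\<close>, and every index is charged
    \<open>b\<close>, so the sum need not be split.\<close>
  have "(\<Sum>i\<in>{a<..a + n}. F i) \<le> (\<Sum>i\<in>{a<..a + n}. (if i \<in> S then B else 0) + b)"
  proof (rule sum_mono)
    fix i
    show "F i \<le> (if i \<in> S then B else 0) + b"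
      using near[of i] far[of i] \<open>b \<ge> 0\<close> by (auto simp: S_def)
  qed
  also have "\<dots> = B * real (card (S \<inter> {a<..a + n})) + real n * b"
    by (simp add: sum.distrib sum.If_cases Int_commute)
  also have "\<dots> \<le> B * (real n / real L + 1) + real n * b"
    using card \<open>B \<ge> 0\<close> by (intro add_right_mono mult_left_mono) auto
  finally show ?thesis .
qed

subsection \<open>Chebyshev bounds\<close>

lemma ln_eq_sum_prime_factors:
  assumes "n > 0"
  shows "ln (real n) = (\<Sum>p\<in>prime_factors n. real (multiplicity p n) * ln (real p))"
proof -
  have "real n = real (\<Prod>p\<in>prime_factors n. p ^ multiplicity p n)"
    using prime_factorization_nat[OF assms] by (rule arg_cong)
  hence "real n = (\<Prod>p\<in>prime_factors n. real p ^ multiplicity p n)"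
    by simp
  hence "ln (real n) = (\<Sum>p\<in>prime_factors n. ln (real p ^ multiplicity p n))"
    by (simp add: ln_prod prime_gt_0_nat in_prime_factors_imp_prime)
  also have "\<dots> = (\<Sum>p\<in>prime_factors n. real (multiplicity p n) * ln (real p))"
    by (intro sum.cong) (auto simp: ln_realpow prime_gt_0_nat in_prime_factors_imp_prime)
  finally show ?thesis .
qed

lemma sum_ln_prime_divisors_le:
  assumes "n > 0" and "\<And>p. p \<in> P \<Longrightarrow> prime p \<and> p dvd n"
  shows "(\<Sum>p\<in>P. ln (real p)) \<le> ln (real n)"
proof -
  have "P \<subseteq> prime_factors n"
    using assms by (auto simp: prime_factors_dvd)
  hence "(\<Sum>p\<in>P. ln (real p)) \<le> (\<Sum>p\<in>prime_factors n. ln (real p))"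
    by (intro sum_mono2) (auto simp: in_prime_factors_imp_prime prime_gt_0_nat Suc_le_eq)
  also have "\<dots> \<le> (\<Sum>p\<in>prime_factors n. real (multiplicity p n) * ln (real p))"
  proof (rule sum_mono)
    fix p assume p: "p \<in> prime_factors n"
    hence "1 \<le> multiplicity p n"
      using assms(1) by (auto simp: prime_factors_multiplicity)
    moreover have "0 \<le> ln (real p)"
      using p by (auto simp: in_prime_factors_imp_prime prime_gt_0_nat Suc_le_eq)
    ultimately show "ln (real p) \<le> real (multiplicity p n) * ln (real p)"
      using mult_right_mono[of 1 "real (multiplicity p n)" "ln (real p)"] by simp
  qed
  also have "\<dots> = ln (real n)" by (rule ln_eq_sum_prime_factors[OF assms(1), symmetric])
  finally show ?thesis .
qed

text \<open>Primes in \<open>{n<..2*n}\<close> divide \<open>fact (2 * n)\<close> but not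
  \<open>fact n\<close>, hence divide the central binomial coefficient, which is at most
  \<open>2 ^ (2 * n)\<close>.\<close>

lemma sum_ln_primes_between_le:
  "(\<Sum>p | prime p \<and> p \<in> {n<..2*n}. ln (real p)) \<le> 2 * real n * ln 2"
proof -
  have "(\<Sum>p | prime p \<and> p \<in> {n<..2*n}. ln (real p)) \<le> ln (real (2 * n choose n))"
  proof (rule sum_ln_prime_divisors_le)
    show "0 < 2 * n choose n" by simp
    fix p assume "p \<in> {p. prime p \<and> p \<in> {n<..2*n}}"
    hence p: "prime p" "n < p" "p \<le> 2 * n" by auto
    have "p dvd fact (2 * n)" using p by (simp add: prime_dvd_fact_iff)
    also have "(fact (2 * n) :: nat) = fact n * fact n * (2 * n choose n)"
      using binomial_fact_lemma[of n "2 * n"] by simp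
    finally show "prime p \<and> p dvd 2 * n choose n"
      using p by (auto simp: prime_dvd_mult_iff prime_dvd_fact_iff)
  qed
  also have "\<dots> \<le> ln (2 ^ (2 * n))"
  proof -
    have "real (2 * n choose n) \<le> real (2 ^ (2 * n))"
      by (rule of_nat_mono[OF binomial_le_pow2])
    thus ?thesis by (subst ln_le_cancel_iff) (simp_all del: of_nat_power)
  qed
  also have "\<dots> = 2 * real n * ln 2" by (subst ln_realpow) auto
  finally show ?thesis .
qed

text \<open>Strong induction by halving: the primes up to \<open>m\<close>, about
  \<open>n / 2\<close>, are covered by the induction hypothesis and those in
  \<open>{m<..2*m}\<close> by the binomial bound.\<close>

lemma chebyshev_theta_le: "(\<Sum>p | prime p \<and> p \<le> n. ln (real p)) \<le> 4 * real n"
proof (induction n rule: less_induct)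
  case (less n)
  show ?case
  proof (cases "n \<le> 1")
    case True
    hence "\<not> p \<le> n" if "prime p" for p :: nat
      using prime_gt_1_nat[OF that] by linarith
    hence none: "{p::nat. prime p \<and> p \<le> n} = {}" by blast
    show ?thesis unfolding none by simp
  next
    case False
    \<comment> \<open>Rounding up ensures \<open>n \<le> 2 * m\<close>; the total
      \<open>6 * m\<close> still fits below \<open>4 * n\<close> because
      \<open>3 * m \<le> 2 * n\<close> once \<open>n \<ge> 2\<close>.\<close>
    define m where "m = (n + 1) div 2"
    have m: "m < n" "n \<le> 2 * m" "3 * m \<le> 2 * n" using False unfolding m_def by linarith+
    have "(\<Sum>p | prime p \<and> p \<le> n. ln (real p)) \<le>
        (\<Sum>p\<in>{p. prime p \<and> p \<le> m} \<union> {p. prime p \<and> p \<in> {m<..2*m}}. ln (real p))"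
    proof (rule sum_mono2)
      show "finite ({p. prime p \<and> p \<le> m} \<union> {p. prime p \<and> p \<in> {m<..2*m}})"
        by (rule finite_subset[of _ "{..2*m}"]) auto
      show "{p. prime p \<and> p \<le> n} \<subseteq> {p. prime p \<and> p \<le> m} \<union> {p. prime p \<and> p \<in> {m<..2*m}}"
        using m by auto
    qed (auto simp: prime_gt_0_nat Suc_le_eq)
    also have "\<dots> = (\<Sum>p | prime p \<and> p \<le> m. ln (real p)) +
        (\<Sum>p | prime p \<and> p \<in> {m<..2*m}. ln (real p))"
      by (intro sum.union_disjoint) auto
    also have "\<dots> \<le> 4 * real m + 2 * real m * ln 2"
      using less.IH[OF m(1)] sum_ln_primes_between_le[of m] by linarith
    also have "\<dots> \<le> 6 * real m"
      using mult_left_le[of "ln 2" "2 * real m"] ln_2_less_1 by linarith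
    also have "\<dots> \<le> 4 * real n" using m(3) by linarith
    finally show ?thesis .
  qed
qed

lemma card_multiples_eq:
  fixes d n :: nat
  assumes "d > 0"
  shows "card {m. m \<in> {1..n} \<and> d dvd m} = n div d"
proof -
  have "{m. m \<in> {1..n} \<and> d dvd m} = (\<lambda>k. d * k) ` {1..n div d}"
  proof (intro equalityI subsetI)
    fix m assume "m \<in> {m. m \<in> {1..n} \<and> d dvd m}"
    then obtain k where k: "m = d * k" "1 \<le> m" "m \<le> n" by auto
    have "k \<le> n div d" using k assms by (simp add: less_eq_div_iff_mult_less_eq mult.commute)
    thus "m \<in> (\<lambda>k. d * k) ` {1..n div d}" using k by (auto intro!: imageI simp: Suc_le_eq)
  next
    fix m assume "m \<in> (\<lambda>k. d * k) ` {1..n div d}"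
    thus "m \<in> {m. m \<in> {1..n} \<and> d dvd m}"
      using assms by (auto simp: less_eq_div_iff_mult_less_eq mult.commute Suc_le_eq)
  qed
  moreover have "inj_on (\<lambda>k. d * k) {1..n div d}" using assms by (auto simp: inj_on_def)
  ultimately show ?thesis by (simp add: card_image)
qed

text \<open>The upper half of Mertens' first theorem. Summing \<open>ln p\<close> over pairs
  \<open>p dvd m\<close> with \<open>m \<le> n\<close> gives at most \<open>n * ln n\<close>;
  replacing \<open>n div p\<close> by \<open>n / p\<close> costs at most the Chebyshev sum.\<close>

lemma sum_ln_over_primes_le:
  assumes "n \<ge> 1"
  shows "(\<Sum>p | prime p \<and> p \<le> n. ln (real p) / real p) \<le> ln (real n) + 4"
proof -
  let ?P = "{p::nat. prime p \<and> p \<le> n}"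
  have "(\<Sum>p\<in>?P. (real n / real p - 1) * ln (real p)) \<le> (\<Sum>p\<in>?P. real (n div p) * ln (real p))"
  proof (rule sum_mono)
    fix p assume "p \<in> ?P"
    hence p: "0 < p" "1 \<le> p" by (auto simp: prime_gt_0_nat prime_gt_0_nat Suc_le_eq)
    have "real n / real p - 1 \<le> real (n div p)"
      using floor_divide_of_nat_eq[of n p, where ?'a = real] by linarith
    thus "(real n / real p - 1) * ln (real p) \<le> real (n div p) * ln (real p)"
      using p by (intro mult_right_mono) auto
  qed
  also have "\<dots> = (\<Sum>p\<in>?P. \<Sum>m | m \<in> {1..n} \<and> p dvd m. ln (real p))"
  proof (rule sum.cong)
    fix p assume "p \<in> ?P"
    hence "0 < p" by (auto simp: prime_gt_0_nat)
    hence "card {m. m \<in> {1..n} \<and> p dvd m} = n div p"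
      using card_multiples_eq[of p n] by simp
    thus "real (n div p) * ln (real p) = (\<Sum>m | m \<in> {1..n} \<and> p dvd m. ln (real p))"
      by simp
  qed auto
  also have "\<dots> = (\<Sum>m\<in>{1..n}. \<Sum>p | p \<in> ?P \<and> p dvd m. ln (real p))"
    by (rule sum.swap_restrict) auto
  also have "\<dots> \<le> (\<Sum>m\<in>{1..n}. ln (real n))"
  proof (rule sum_mono)
    fix m assume m: "m \<in> {1..n}"
    have "(\<Sum>p | p \<in> ?P \<and> p dvd m. ln (real p)) \<le> ln (real m)"
      using m by (intro sum_ln_prime_divisors_le) auto
    also have "\<dots> \<le> ln (real n)" using m by simp
    finally show "(\<Sum>p | p \<in> ?P \<and> p dvd m. ln (real p)) \<le> ln (real n)" .
  qed
  also have "\<dots> = real n * ln (real n)" by simp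
  finally have "real n * (\<Sum>p\<in>?P. ln (real p) / real p) - (\<Sum>p\<in>?P. ln (real p)) \<le> real n * ln (real n)"
    by (simp add: sum_distrib_left sum_subtractf algebra_simps)
  with chebyshev_theta_le[of n]
  have "real n * (\<Sum>p\<in>?P. ln (real p) / real p) \<le> real n * (ln (real n) + 4)"
    by (simp add: algebra_simps)
  thus ?thesis using assms by simp
qed

subsection \<open>Fourier expansion of the sawtooth\<close>

text \<open>Concavity of the sine on \<open>{0..pi/2}\<close> puts it above its chord, which even
  gives \<open>2 * x\<close>.\<close>

lemma sin_pi_times_ge:
  fixes x :: real
  assumes "0 \<le> x" "x \<le> 1/2"
  shows "x \<le> sin (pi * x)"
proof -
  have "convex_on {0..pi/2} (\<lambda>x. - sin x)"
  proof (rule f''_ge0_imp_convex)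
    fix x :: real
    assume x: "x \<in> {0..pi/2}"
    show "((\<lambda>x. - sin x) has_real_derivative (- cos x)) (at x)"
      by (auto intro!: derivative_eq_intros)
    show "((\<lambda>x. - cos x) has_real_derivative (sin x)) (at x)"
      by (auto intro!: derivative_eq_intros)
    show "0 \<le> sin x" using x by (intro sin_ge_zero) auto
  qed auto
  from convex_onD[OF this, of "2 * x" 0 "pi / 2"]
  have "2 * x \<le> sin (pi * x)" using assms by (simp add: mult.commute)
  thus ?thesis using assms by linarith
qed

lemma sin_pi_times_diff_int: "\<bar>sin (pi * (x - of_int n))\<bar> = \<bar>sin (pi * x)\<bar>"
proof -
  have "sin (pi * (x - of_int n)) = sin (pi * x) * cos (pi * of_int n)"
    by (simp add: right_diff_distrib sin_diff sin_int_times_real mult.commute)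
  moreover have "\<bar>cos (pi * of_int n)\<bar> = 1"
    by (simp add: mult.commute)
  ultimately show ?thesis by (simp add: abs_mult)
qed

lemma dist_nint_le_sin: "dist_nint x \<le> \<bar>sin (pi * x)\<bar>"
proof -
  define r where "r = x - of_int (round x)"
  have r: "\<bar>r\<bar> \<le> 1/2" "dist_nint x = \<bar>r\<bar>"
    using of_int_round_abs_le[of x] by (auto simp: r_def dist_nint_def abs_minus_commute)
  have "\<bar>r\<bar> \<le> \<bar>sin (pi * r)\<bar>"
  proof (cases "r \<ge> 0")
    case True
    thus ?thesis using sin_pi_times_ge[of r] r by simp
  next
    case False
    thus ?thesis using sin_pi_times_ge[of "- r"] r by simp
  qed
  thus ?thesis using sin_pi_times_diff_int[of x "round x"] r by (simp add: r_def)
qed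

text \<open>The Fourier series of the sawtooth \<open>frac x - 1/2\<close> is minus the sum of
  \<open>sin (2 * pi * k * x) / (pi * k)\<close>, so this is the error left by its partial sum of
  length \<open>K\<close>.\<close>

definition saw_err :: "nat \<Rightarrow> real \<Rightarrow> real" where
  "saw_err K x = frac x - 1/2 + (\<Sum>k=1..K. sin (2 * pi * real k * x) / (pi * real k))"

text \<open>Between integers the cosine sum plus 1 is the derivative of \<open>saw_err K\<close>;
  the closed form is what makes that derivative integrable by parts.\<close>

lemma dirichlet_kernel:
  "sin (pi * x) * (1 + (\<Sum>k=1..K. 2 * cos (2 * pi * real k * x))) = sin ((2 * real K + 1) * pi * x)"
proof (induction K)
  case (Suc K)
  define u where "u = 2 * pi * real (Suc K) * x"
  have "sin (pi * x) * (1 + (\<Sum>k=1..Suc K. 2 * cos (2 * pi * real k * x))) =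
      sin (pi * x) * (1 + (\<Sum>k=1..K. 2 * cos (2 * pi * real k * x))) + 2 * sin (pi * x) * cos u"
    by (simp add: u_def algebra_simps)
  also have "\<dots> = sin ((2 * real K + 1) * pi * x) + 2 * sin (pi * x) * cos u"
    by (simp only: Suc.IH)
  also have "(2 * real K + 1) * pi * x = u - pi * x"
    by (simp add: u_def algebra_simps)
  also have "sin (u - pi * x) + 2 * sin (pi * x) * cos u = sin (u + pi * x)"
    by (simp add: sin_add sin_diff)
  also have "u + pi * x = (2 * real (Suc K) + 1) * pi * x"
    by (simp add: u_def algebra_simps)
  finally show ?case .
qed simp

text \<open>The derivative of the error is \<open>sin (M * pi * x) / sin (pi * x)\<close> with
  \<open>M = 2 * K + 1\<close>. One integration by parts from \<open>x\<close> to \<open>1/2\<close>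
  gains the factor \<open>1 / M\<close>; it is carried out through monotonicity instead of
  integrals.\<close>

lemma saw_err_near_0:
  assumes x: "0 < x" "x \<le> 1/2"
  shows "\<bar>saw_err K x\<bar> \<le> 1 / ((2 * real K + 1) * x)"
proof -
  \<comment> \<open>Here \<open>G\<close> is the error with the boundary term of the integration by
    parts added, and \<open>h\<close> is the size of that boundary term; the remaining derivative
    \<open>G'\<close> is dominated by \<open>- h'\<close>.\<close>
  define M where "M = 2 * real K + 1"
  have M: "M \<ge> 1" by (simp add: M_def)
  define G where "G = (\<lambda>x. x - 1/2 + (\<Sum>k=1..K. sin (2 * pi * real k * x) / (pi * real k))
      + cos (M * pi * x) / (M * pi * sin (pi * x)))"
  define h where "h = (\<lambda>x::real. 1 / (M * pi * sin (pi * x)))"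
  define G' where "G' = (\<lambda>x. - cos (M * pi * x) * cos (pi * x) / (M * (sin (pi * x))\<^sup>2))"
  define h' where "h' = (\<lambda>x. - cos (pi * x) / (M * (sin (pi * x))\<^sup>2))"
  have sin_pos: "0 < sin (pi * y)" if "0 < y" "y \<le> 1/2" for y
    using sin_pi_times_ge[of y] that by linarith
  have G: "(G has_real_derivative G' y) (at y)" if y: "0 < y" "y \<le> 1/2" for y
  proof -
    note s = sin_pos[OF y]
    have "((\<lambda>x. x - 1/2 + (\<Sum>k=1..K. sin (2 * pi * real k * x) / (pi * real k)))
        has_real_derivative (1 + (\<Sum>k=1..K. 2 * cos (2 * pi * real k * y)))) (at y)"
      by (auto intro!: derivative_eq_intros sum.cong)
    also have "1 + (\<Sum>k=1..K. 2 * cos (2 * pi * real k * y)) = sin (M * pi * y) / sin (pi * y)"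
      using dirichlet_kernel[of y K] s by (simp add: field_simps M_def)
    finally have "((\<lambda>x. x - 1/2 + (\<Sum>k=1..K. sin (2 * pi * real k * x) / (pi * real k)))
        has_real_derivative (sin (M * pi * y) / sin (pi * y))) (at y)" .
    moreover have "((\<lambda>x. cos (M * pi * x) / (M * pi * sin (pi * x))) has_real_derivative
        ((- sin (M * pi * y) * (M * pi) * (M * pi * sin (pi * y))
          - cos (M * pi * y) * (M * pi * (cos (pi * y) * pi))) / (M * pi * sin (pi * y))\<^sup>2)) (at y)"
      using s M by (auto intro!: derivative_eq_intros simp: power2_eq_square)
    ultimately have "(G has_real_derivative (sin (M * pi * y) / sin (pi * y)
        + (- sin (M * pi * y) * (M * pi) * (M * pi * sin (pi * y))
          - cos (M * pi * y) * (M * pi * (cos (pi * y) * pi))) / (M * pi * sin (pi * y))\<^sup>2)) (at y)"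
      unfolding G_def by (rule DERIV_add)
    also have "(sin (M * pi * y) / sin (pi * y)
        + (- sin (M * pi * y) * (M * pi) * (M * pi * sin (pi * y))
          - cos (M * pi * y) * (M * pi * (cos (pi * y) * pi))) / (M * pi * sin (pi * y))\<^sup>2) = G' y"
      using s M by (simp add: G'_def field_simps power2_eq_square)
    finally show ?thesis .
  qed
  have h: "(h has_real_derivative h' y) (at y)" if y: "0 < y" "y \<le> 1/2" for y
    unfolding h_def h'_def using sin_pos[OF y] M
    by (auto intro!: derivative_eq_intros simp: power2_eq_square field_simps)
  have bd: "\<bar>G' y\<bar> \<le> - h' y" if y: "0 < y" "y \<le> 1/2" for y
  proof -
    have "0 \<le> cos (pi * y)" using y mult_left_mono[of y "1/2" pi] by (intro cos_ge_zero) (auto intro: order_trans[of _ 0])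
    hence "\<bar>cos (M * pi * y)\<bar> * cos (pi * y) \<le> 1 * cos (pi * y)"
      by (intro mult_right_mono) auto
    thus ?thesis using \<open>0 \<le> cos (pi * y)\<close> M
      by (simp add: G'_def h'_def abs_mult divide_right_mono)
  qed
  have "G (1/2) = 0"
  proof -
    have "cos (M * pi * (1/2)) = 0"
      unfolding M_def cos_zero_iff by (intro disjI1 exI[of _ "2 * K + 1"]) (auto simp: field_simps)
    moreover have "sin (2 * pi * real k * (1/2)) = 0" for k
      by (simp add: mult.commute)
    ultimately show ?thesis by (simp add: G_def)
  qed
  have "h (1/2) \<ge> 0" using M by (simp add: h_def)
  \<comment> \<open>Since \<open>\<bar>G'\<bar> \<le> - h'\<close>, the function
    \<open>G + h\<close> decreases and \<open>G - h\<close> increases towards \<open>1/2\<close>,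
    where \<open>G\<close> vanishes; together they give
    \<open>\<bar>G x\<bar> \<le> h x\<close>.\<close>
  have "G (1/2) + h (1/2) \<le> G x + h x"
  proof (rule DERIV_nonpos_imp_nonincreasing[OF x(2)])
    fix y assume "x \<le> y" "y \<le> 1/2"
    hence y: "0 < y" "y \<le> 1/2" using x by auto
    show "\<exists>D. ((\<lambda>x. G x + h x) has_real_derivative D) (at y) \<and> D \<le> 0"
      using DERIV_add[OF G[OF y] h[OF y]] bd[OF y] by (intro exI[of _ "G' y + h' y"]) auto
  qed
  moreover have "G x - h x \<le> G (1/2) - h (1/2)"
  proof (rule DERIV_nonneg_imp_nondecreasing[OF x(2)])
    fix y assume "x \<le> y" "y \<le> 1/2"
    hence y: "0 < y" "y \<le> 1/2" using x by auto
    show "\<exists>D. ((\<lambda>x. G x - h x) has_real_derivative D) (at y) \<and> 0 \<le> D"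
      using DERIV_diff[OF G[OF y] h[OF y]] bd[OF y] by (intro exI[of _ "G' y - h' y"]) auto
  qed
  ultimately have "\<bar>G x\<bar> \<le> h x"
    using \<open>G (1/2) = 0\<close> \<open>h (1/2) \<ge> 0\<close> by linarith
  moreover have "\<bar>cos (M * pi * x) / (M * pi * sin (pi * x))\<bar> \<le> h x"
    using sin_pos[OF x] M by (simp add: h_def abs_mult divide_right_mono)
  moreover have "saw_err K x = G x - cos (M * pi * x) / (M * pi * sin (pi * x))"
    using x by (simp add: G_def saw_err_def frac_eq)
  ultimately have "\<bar>saw_err K x\<bar> \<le> 2 * h x" by linarith
  also have "2 * h x \<le> 2 / (M * pi * x)"
    using sin_pi_times_ge[of x] x M sin_pos[OF x]
    by (auto simp: h_def intro!: divide_left_mono mult_left_mono)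
  also have "\<dots> \<le> 1 / (M * x)"
    using pi_gt3 x M by (simp add: field_simps)
  finally show ?thesis by (simp add: M_def)
qed

text \<open>Beyond distance \<open>1 / (2 * K + 1)\<close> the decay bound is at most 1. Closer to 0
  each of the \<open>K\<close> sine terms is at most \<open>2 * x\<close>, so their sum stays below
  1.\<close>

lemma saw_err_le_2_near_0:
  assumes x: "0 < x" "x \<le> 1/2"
  shows "\<bar>saw_err K x\<bar> \<le> 2"
proof (cases "1 \<le> (2 * real K + 1) * x")
  case True
  have "\<bar>saw_err K x\<bar> \<le> 1 / ((2 * real K + 1) * x)" by (rule saw_err_near_0[OF x])
  also have "\<dots> \<le> 1" using True by (simp add: divide_le_eq)
  finally show ?thesis by simp
next
  case False
  have "\<bar>\<Sum>k=1..K. sin (2 * pi * real k * x) / (pi * real k)\<bar> \<le> (\<Sum>k=1..K. 2 * x)"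
  proof (rule order_trans[OF sum_abs sum_mono])
    fix k assume k: "k \<in> {1..K}"
    have "\<bar>sin (2 * pi * real k * x)\<bar> \<le> \<bar>2 * pi * real k * x\<bar>" by (rule abs_sin_x_le_abs_x)
    also have "\<dots> = 2 * x * (pi * real k)" using x by simp
    finally show "\<bar>sin (2 * pi * real k * x) / (pi * real k)\<bar> \<le> 2 * x"
      using k by (simp add: abs_mult pos_divide_le_eq)
  qed
  moreover have "\<bar>frac x - 1/2\<bar> \<le> 1/2"
    using frac_ge_0[of x] frac_lt_1[of x] by linarith
  ultimately show ?thesis
    using False x unfolding saw_err_def by (simp add: algebra_simps)
qed

lemma saw_err_diff_int: "saw_err K (x - of_int n) = saw_err K x"
proof -
  have "sin (2 * pi * real k * (x - of_int n)) = sin (2 * pi * real k * x)" for k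
  proof -
    have "2 * pi * real k * (x - of_int n) = 2 * pi * real k * x - 2 * pi * of_int (int k * n)"
      by (simp add: algebra_simps)
    thus ?thesis by (simp add: sin_diff del: of_int_mult)
  qed
  moreover have "frac (x - of_int n) = frac x" by (simp add: frac_def)
  ultimately show ?thesis by (simp add: saw_err_def)
qed

lemma saw_err_minus:
  assumes "x \<notin> \<int>"
  shows "saw_err K (- x) = - saw_err K x"
  using assms by (simp add: saw_err_def frac_neg sum_negf)

text \<open>Periodicity reduces to the nearest integer and oddness to the positive side. The first
  bound holds uniformly in \<open>K\<close> and at every point, the second only away from the
  integers.\<close>

lemma saw_err_le:
  "\<bar>saw_err K x\<bar> \<le> 2"
  "0 < dist_nint x \<Longrightarrow> \<bar>saw_err K x\<bar> \<le> 1 / ((2 * real K + 1) * dist_nint x)"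
proof -
  define r where "r = x - of_int (round x)"
  have r: "\<bar>r\<bar> \<le> 1/2" "dist_nint x = \<bar>r\<bar>"
    using of_int_round_abs_le[of x] by (auto simp: r_def dist_nint_def abs_minus_commute)
  have eq: "saw_err K x = saw_err K r"
    by (simp add: r_def saw_err_diff_int)
  consider "r = 0" | "r > 0" | "r < 0" by linarith
  hence "\<bar>saw_err K x\<bar> \<le> 2 \<and>
      (0 < dist_nint x \<longrightarrow> \<bar>saw_err K x\<bar> \<le> 1 / ((2 * real K + 1) * dist_nint x))"
  proof cases
    case 1
    \<comment> \<open>At an integer all sines vanish and \<open>frac\<close> is 0, so the error does
      not decay with \<open>K\<close>; the second bound is vacuous there.\<close>
    hence "saw_err K r = - 1 / 2" by (simp add: saw_err_def)
    thus ?thesis using r 1 by (simp add: eq)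
  next
    case 2
    thus ?thesis using r saw_err_near_0[of r K] saw_err_le_2_near_0[of r K] by (simp add: eq)
  next
    case 3
    \<comment> \<open>Reflection needs \<open>frac (- x) = 1 - frac x\<close>, which fails at
      integers.\<close>
    have "- r \<notin> \<int>"
    proof
      assume "- r \<in> \<int>"
      then obtain n where n: "- r = of_int n" by (rule Ints_cases)
      hence "0 < n" "n < 1" using 3 r(1) by linarith+
      thus False by simp
    qed
    hence "saw_err K r = - saw_err K (- r)"
      using saw_err_minus[of "- r" K] by simp
    thus ?thesis using r 3 saw_err_near_0[of "- r" K] saw_err_le_2_near_0[of "- r" K] by (simp add: eq)
  qed
  thus "\<bar>saw_err K x\<bar> \<le> 2"
    "0 < dist_nint x \<Longrightarrow> \<bar>saw_err K x\<bar> \<le> 1 / ((2 * real K + 1) * dist_nint x)" by auto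
qed

subsection \<open>A bilinear estimate\<close>

lemma norm_one_minus_cis: "cmod (1 - cis (2 * pi * \<omega>)) = 2 * \<bar>sin (pi * \<omega>)\<bar>"
  using dist_exp_i_1[of "2 * pi * \<omega>"] by (simp add: cis_conv_exp norm_minus_commute)

text \<open>Multiplication by \<open>1 - z\<close> telescopes the sum to two unimodular terms, and
  \<open>cmod (1 - z)\<close> is at least twice the distance of \<omega> to the integers.\<close>

lemma norm_geometric_cis_le:
  assumes "0 < dist_nint \<omega>"
  shows "cmod (\<Sum>m\<in>{a<..b}. cis (2 * pi * (real m * \<omega>))) \<le> 1 / dist_nint \<omega>"
proof (cases "a \<le> b")
  case True
  define z where "z = cis (2 * pi * \<omega>)"
  have z: "cis (2 * pi * (real m * \<omega>)) = z ^ m" for m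
    unfolding z_def Complex.DeMoivre by (rule arg_cong[where f = cis]) simp
  have pos: "2 * dist_nint \<omega> \<le> cmod (1 - z)"
    using dist_nint_le_sin[of \<omega>] norm_one_minus_cis[of \<omega>] by (simp add: z_def)
  have "(1 - z) * (\<Sum>m\<in>{a<..b}. z ^ m) = (\<Sum>m\<in>{Suc a..b}. z ^ m - z ^ Suc m)"
    by (simp add: sum_distrib_left atLeastSucAtMost_greaterThanAtMost algebra_simps)
  also have "\<dots> = z ^ Suc a - z ^ Suc b"
    using True sum_Suc_diff[of "Suc a" b "\<lambda>m. - (z ^ m)"] by simp
  finally have "cmod (1 - z) * cmod (\<Sum>m\<in>{a<..b}. z ^ m) = cmod (z ^ Suc a - z ^ Suc b)"
    by (metis norm_mult)
  also have "\<dots> \<le> cmod (z ^ Suc a) + cmod (z ^ Suc b)" by (rule norm_triangle_ineq4)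
  also have "\<dots> = 2" by (simp add: z_def norm_power norm_mult)
  finally have "cmod (1 - z) * cmod (\<Sum>m\<in>{a<..b}. z ^ m) \<le> 2" .
  moreover have "2 * dist_nint \<omega> * cmod (\<Sum>m\<in>{a<..b}. z ^ m)
      \<le> cmod (1 - z) * cmod (\<Sum>m\<in>{a<..b}. z ^ m)"
    using pos by (intro mult_right_mono) auto
  ultimately show ?thesis
    using assms unfolding z by (simp add: field_simps)
qed (use assms in auto)

text \<open>Cauchy--Schwarz in \<open>m\<close> leaves, for each pair \<open>p, p'\<close>, a geometric sum in \<open>m\<close> over an interval,
  so the hyperbolic condition \<open>p * m \<le> N\<close> costs nothing.\<close>

lemma bilinear_block:
  fixes a b :: "nat \<Rightarrow> complex" and P M N L :: nat and \<omega> \<delta> A :: real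
  assumes sep: "\<And>h. 1 \<le> h \<Longrightarrow> h < L \<Longrightarrow> \<delta> \<le> dist_nint (real h * \<omega>)"
    and "L \<ge> 1" and "\<delta> > 0" and "P \<ge> 1"
    and a: "\<And>p. p \<in> {P<..P + P} \<Longrightarrow> cmod (a p) \<le> A"
  shows "(cmod (\<Sum>p\<in>{P<..P + P}. \<Sum>m\<in>{M<..N div p}. a p * b m * cis (2 * pi * (real (p * m) * \<omega>))))\<^sup>2
    \<le> (\<Sum>m=1..N div P. (cmod (b m))\<^sup>2) *
      (A\<^sup>2 * real P * (real (N div P) * (real P / real L + 1) + real P * (2 / \<delta>)))"
proof -
  define X where "X = N div P"
  define I where "I = {P<..P + P}"
  define e where "e = (\<lambda>p m. cis (2 * pi * (real (p * m) * \<omega>)))"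
  define G where "G = (\<lambda>m. \<Sum>p | p \<in> I \<and> p * m \<le> N. a p * e p m)"
  have A: "A \<ge> 0" using order_trans[OF norm_ge_zero a[of "P + 1"]] \<open>P \<ge> 1\<close> by simp
  have range: "{M<..N div p} = {m \<in> {M<..X}. p * m \<le> N}" if "p \<in> I" for p
  proof -
    have p: "0 < p" "P \<le> p" using that by (auto simp: I_def)
    have "N div p \<le> X" unfolding X_def using p \<open>P \<ge> 1\<close> by (intro div_le_mono2) auto
    have iff: "m \<le> N div p \<longleftrightarrow> p * m \<le> N" for m
      using p by (simp add: less_eq_div_iff_mult_less_eq mult.commute)
    have "m \<le> X" if "p * m \<le> N" for m
      using \<open>N div p \<le> X\<close> that unfolding iff[symmetric] by (rule order_trans[rotated])
    thus ?thesis by (auto simp: iff)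
  qed
  \<comment> \<open>Writing the range as a condition inside \<open>{M<..X}\<close>, a range free of
    \<open>p\<close>, allows the two sums to be exchanged.\<close>
  have "(\<Sum>p\<in>I. \<Sum>m\<in>{M<..N div p}. a p * b m * e p m)
      = (\<Sum>p\<in>I. \<Sum>m | m \<in> {M<..X} \<and> p * m \<le> N. a p * b m * e p m)"
    by (intro sum.cong) (auto simp: range)
  also have "\<dots> = (\<Sum>m\<in>{M<..X}. \<Sum>p | p \<in> I \<and> p * m \<le> N. a p * b m * e p m)"
    by (rule sum.swap_restrict) (auto simp: I_def)
  also have "\<dots> = (\<Sum>m\<in>{M<..X}. b m * G m)"
    by (simp add: G_def sum_distrib_left mult_ac)
  finally have eq: "(\<Sum>p\<in>I. \<Sum>m\<in>{M<..N div p}. a p * b m * e p m) = (\<Sum>m\<in>{M<..X}. b m * G m)" .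
  have "cmod (\<Sum>m\<in>{M<..X}. b m * G m) \<le> (\<Sum>m\<in>{M<..X}. cmod (b m) * cmod (G m))"
    by (rule order_trans[OF norm_sum]) (simp add: norm_mult)
  hence "(cmod (\<Sum>m\<in>{M<..X}. b m * G m))\<^sup>2 \<le> (\<Sum>m\<in>{M<..X}. cmod (b m) * cmod (G m))\<^sup>2"
    by (intro power_mono) auto
  also have "\<dots> \<le> (\<Sum>m\<in>{M<..X}. (cmod (b m))\<^sup>2) * (\<Sum>m\<in>{M<..X}. (cmod (G m))\<^sup>2)"
    by (rule Cauchy_Schwarz_ineq_sum)
  also have "\<dots> \<le> (\<Sum>m=1..X. (cmod (b m))\<^sup>2) *
      (A\<^sup>2 * real P * (real X * (real P / real L + 1) + real P * (2 / \<delta>)))"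
  proof (rule mult_mono)
    show "(\<Sum>m\<in>{M<..X}. (cmod (b m))\<^sup>2) \<le> (\<Sum>m=1..X. (cmod (b m))\<^sup>2)"
      by (intro sum_mono2) auto
    define D where "D = (\<lambda>p q. \<Sum>m | m \<in> {M<..X} \<and> p * m \<le> N \<and> q * m \<le> N.
        cis (2 * pi * (real m * (real p * \<omega> - real q * \<omega>))))"
    have "of_real ((cmod (G m))\<^sup>2) = (\<Sum>p\<in>I. \<Sum>q\<in>I. if p * m \<le> N \<and> q * m \<le> N
        then a p * cnj (a q) * cis (2 * pi * (real m * (real p * \<omega> - real q * \<omega>))) else 0)" for m
    proof -
      have Gm: "G m = (\<Sum>p\<in>I. if p * m \<le> N then a p * e p m else 0)"
        unfolding G_def by (subst sum.inter_filter) (auto simp: I_def)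
      have "of_real ((cmod (G m))\<^sup>2) = G m * cnj (G m)" by (simp only: complex_norm_square)
      also have "\<dots> = (\<Sum>p\<in>I. \<Sum>q\<in>I. (if p * m \<le> N then a p * e p m else 0) *
            cnj (if q * m \<le> N then a q * e q m else 0))"
        by (simp only: Gm cnj_sum sum_product)
      also have "\<dots> = (\<Sum>p\<in>I. \<Sum>q\<in>I. if p * m \<le> N \<and> q * m \<le> N
        then a p * cnj (a q) * cis (2 * pi * (real m * (real p * \<omega> - real q * \<omega>))) else 0)"
      proof (intro sum.cong refl)
        fix p q
        have "e p m * cnj (e q m) = cis (2 * pi * (real m * (real p * \<omega> - real q * \<omega>)))"
          by (simp add: e_def cis_cnj cis_mult algebra_simps)
        thus "(if p * m \<le> N then a p * e p m else 0) * cnj (if q * m \<le> N then a q * e q m else 0) =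
          (if p * m \<le> N \<and> q * m \<le> N
            then a p * cnj (a q) * cis (2 * pi * (real m * (real p * \<omega> - real q * \<omega>))) else 0)"
          by (auto simp: mult_ac)
      qed
      finally show ?thesis .
    qed
    hence "of_real (\<Sum>m\<in>{M<..X}. (cmod (G m))\<^sup>2) = (\<Sum>m\<in>{M<..X}. \<Sum>p\<in>I. \<Sum>q\<in>I.
        if p * m \<le> N \<and> q * m \<le> N
        then a p * cnj (a q) * cis (2 * pi * (real m * (real p * \<omega> - real q * \<omega>))) else 0)"
      by (simp only: of_real_sum)
    also have "\<dots> = (\<Sum>p\<in>I. \<Sum>q\<in>I. \<Sum>m\<in>{M<..X}. 
        if p * m \<le> N \<and> q * m \<le> N
        then a p * cnj (a q) * cis (2 * pi * (real m * (real p * \<omega> - real q * \<omega>))) else 0)"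
      by (rule trans[OF sum.swap sum.cong[OF refl sum.swap]])
    also have "\<dots> = (\<Sum>p\<in>I. \<Sum>q\<in>I. a p * cnj (a q) * D p q)"
    proof (intro sum.cong refl)
      fix p q
      show "(\<Sum>m\<in>{M<..X}. if p * m \<le> N \<and> q * m \<le> N
        then a p * cnj (a q) * cis (2 * pi * (real m * (real p * \<omega> - real q * \<omega>))) else 0)
        = a p * cnj (a q) * D p q"
        unfolding D_def sum_distrib_left by (subst sum.inter_filter) auto
    qed
    \<comment> \<open>The sum of squares is a nonnegative real, hence equal to the norm of the
      double sum into which it was expanded.\<close>
    finally have "(\<Sum>m\<in>{M<..X}. (cmod (G m))\<^sup>2) = cmod (\<Sum>p\<in>I. \<Sum>q\<in>I. a p * cnj (a q) * D p q)"
      by (metis (no_types, lifting) abs_of_nonneg norm_of_real sum_nonneg zero_le_power2)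
    also have "\<dots> \<le> (\<Sum>p\<in>I. \<Sum>q\<in>I. A\<^sup>2 * cmod (D p q))"
    proof (rule order_trans[OF norm_sum sum_mono], rule order_trans[OF norm_sum sum_mono])
      fix p q assume "p \<in> I" "q \<in> I"
      hence "cmod (a p) * cmod (a q) \<le> A * A" using a A by (intro mult_mono) (auto simp: I_def)
      thus "cmod (a p * cnj (a q) * D p q) \<le> A\<^sup>2 * cmod (D p q)"
        by (simp add: norm_mult power2_eq_square mult_right_mono)
    qed
    also have "\<dots> = (\<Sum>p\<in>I. A\<^sup>2 * (\<Sum>q\<in>I. cmod (D p q)))"
      by (simp add: sum_distrib_left)
    also have "\<dots> \<le> (\<Sum>p\<in>I. A\<^sup>2 * (real X * (real P / real L + 1) + real P * (2 / \<delta>)))"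
    proof (intro sum_mono mult_left_mono)
      fix p assume "p \<in> I"
      show "(\<Sum>q\<in>I. cmod (D p q)) \<le> real X * (real P / real L + 1) + real P * (2 / \<delta>)"
        unfolding I_def
      \<comment> \<open>For fixed \<open>p\<close> the frequencies of the sums over \<open>m\<close>
        form, up to sign, a rotation indexed by \<open>q\<close>. Near an integer
        \<open>D p q\<close> gets the trivial bound \<open>X\<close>, elsewhere the geometric
        bound.\<close>
      proof (rule sum_rotation_le[where \<omega> = \<omega> and y = "- (real p * \<omega>)" and \<delta> = \<delta>])
        fix q
        have "cmod (D p q) \<le> (\<Sum>m | m \<in> {M<..X} \<and> p * m \<le> N \<and> q * m \<le> N. 1)"
          unfolding D_def by (rule order_trans[OF norm_sum]) simp
        also have "\<dots> \<le> (\<Sum>m\<in>{1..X}. 1)"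
          by (intro sum_mono2) auto
        finally show "cmod (D p q) \<le> real X" by simp
      next
        fix q assume far: "\<delta> / 2 \<le> dist_nint (- (real p * \<omega>) + real q * \<omega>)"
        define x where "x = real p * \<omega> - real q * \<omega>"
        have x: "\<delta> / 2 \<le> dist_nint x"
          using far dist_nint_minus[of x] by (simp add: x_def)
        have "0 < p" using \<open>p \<in> I\<close> by (auto simp: I_def)
        \<comment> \<open>The hypothesis on far points ranges over all naturals, so
          \<open>q = 0\<close> has to be covered too; there the condition on \<open>q\<close> is
          always true. In both cases \<open>m\<close> runs over an interval.\<close>
        obtain B where B: "{m. m \<in> {M<..X} \<and> p * m \<le> N \<and> q * m \<le> N} = {M<..B}"
        proof (cases "q = 0")
          case True
          have "{m. m \<in> {M<..X} \<and> p * m \<le> N \<and> q * m \<le> N} = {M<..min X (N div p)}"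
            using True \<open>0 < p\<close> by (auto simp: less_eq_div_iff_mult_less_eq mult.commute)
          thus ?thesis by (rule that)
        next
          case False
          have "{m. m \<in> {M<..X} \<and> p * m \<le> N \<and> q * m \<le> N} = {M<..min X (min (N div p) (N div q))}"
            using False \<open>0 < p\<close> by (auto simp: less_eq_div_iff_mult_less_eq mult.commute)
          thus ?thesis by (rule that)
        qed
        have "cmod (D p q) \<le> 1 / dist_nint x"
          unfolding D_def B x_def[symmetric]
          using x \<open>\<delta> > 0\<close> by (intro norm_geometric_cis_le) auto
        also have "\<dots> \<le> 1 / (\<delta> / 2)"
          using x \<open>\<delta> > 0\<close> by (intro divide_left_mono) auto
        finally show "cmod (D p q) \<le> 2 / \<delta>" by simp
      qed (use assms in auto)
    qed auto
    also have "\<dots> = A\<^sup>2 * real P * (real X * (real P / real L + 1) + real P * (2 / \<delta>))"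
      by (simp add: I_def)
    finally show "(\<Sum>m\<in>{M<..X}. (cmod (G m))\<^sup>2)
      \<le> A\<^sup>2 * real P * (real X * (real P / real L + 1) + real P * (2 / \<delta>))" .
  qed (auto intro: sum_nonneg)
  finally show ?thesis
    unfolding eq[symmetric] unfolding I_def e_def X_def .
qed

subsection \<open>Mean values of multiplicative functions\<close>

lemma FA_cauchy:
  assumes "f \<in> FA A" "A \<ge> 0" "\<And>n. g n \<ge> 0" "(\<Sum>n=1..N. (g n)\<^sup>2) \<le> S"
  shows "(\<Sum>n=1..N. cmod (f n) * g n) \<le> A * sqrt (real N * S)"
proof (rule power2_le_imp_le)
  have S: "0 \<le> S" using assms(4) by (rule order_trans[rotated]) (auto intro: sum_nonneg)
  have "(\<Sum>n=1..N. cmod (f n) * g n)\<^sup>2 \<le> (\<Sum>n=1..N. (cmod (f n))\<^sup>2) * (\<Sum>n=1..N. (g n)\<^sup>2)"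
    by (rule Cauchy_Schwarz_ineq_sum)
  also have "\<dots> \<le> (A\<^sup>2 * real N) * S"
    using assms by (intro mult_mono sum_nonneg) (auto simp: FA_def)
  also have "\<dots> = (A * sqrt (real N * S))\<^sup>2"
    using S by (simp add: power_mult_distrib)
  finally show "(\<Sum>n=1..N. cmod (f n) * g n)\<^sup>2 \<le> (A * sqrt (real N * S))\<^sup>2" .
  show "0 \<le> A * sqrt (real N * S)" using S assms by simp
qed

lemma FA_cauchy':
  assumes "f \<in> FA A" "A \<ge> 0" "\<And>n. g n \<ge> 0" "(\<Sum>n=1..N. (g n)\<^sup>2) \<le> C * real N"
  shows "(\<Sum>n=1..N. cmod (f n) * g n) \<le> A * sqrt C * real N"
  using FA_cauchy[OF assms] by (simp add: real_sqrt_mult mult_ac)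

lemma FA_sum_le:
  assumes "f \<in> FA A" "A \<ge> 0"
  shows "(\<Sum>n=1..N. cmod (f n)) \<le> A * real N"
  using FA_cauchy'[OF assms, of "\<lambda>_. 1" N 1] by simp

text \<open>Cauchy--Schwarz against the indicator of the multiples of \<open>d\<close> saves a
  factor \<open>sqrt d\<close>; for \<open>d = p\<close> this makes the correction from
  \<open>p dvd m\<close> summable over primes.\<close>

lemma FA_sum_multiples_le:
  assumes "f \<in> FA A" "A \<ge> 0" "d > 0"
  shows "(\<Sum>m | m \<in> {1..n} \<and> d dvd m. cmod (f m)) \<le> A * real n / sqrt (real d)"
proof -
  have "(\<Sum>m | m \<in> {1..n} \<and> d dvd m. cmod (f m)) = (\<Sum>m=1..n. cmod (f m) * (if d dvd m then 1 else 0))"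
    by (subst sum.inter_filter) (auto intro!: sum.cong)
  also have "\<dots> \<le> A * sqrt (real n * (real n / real d))"
  proof (rule FA_cauchy[OF assms(1,2)])
    have "(\<Sum>m=1..n. (if d dvd m then 1 else 0 :: real)\<^sup>2) = (\<Sum>m | m \<in> {1..n} \<and> d dvd m. 1)"
      by (subst sum.inter_filter) (auto intro!: sum.cong)
    also have "\<dots> = real (n div d)"
      using card_multiples_eq[OF assms(3), of n] by simp
    also have "\<dots> \<le> real n / real d" by (rule of_nat_div_le_of_nat)
    finally show "(\<Sum>m=1..n. (if d dvd m then 1 else 0 :: real)\<^sup>2) \<le> real n / real d" .
  qed auto
  also have "\<dots> = A * real n / sqrt (real d)"
    by (simp add: real_sqrt_mult real_sqrt_divide)
  finally show ?thesis .
qed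

lemma sum_inverse_sqrt_le: "(\<Sum>n=1..N. 1 / sqrt (real n)) \<le> 2 * sqrt (real N)"
proof (induction N)
  case (Suc N)
  have "1 / sqrt (real (Suc N)) \<le> 2 * (sqrt (real (Suc N)) - sqrt (real N))"
  proof -
    have "sqrt (real N) \<le> sqrt (real (Suc N))" by simp
    have "1 = (sqrt (real (Suc N)) - sqrt (real N)) * (sqrt (real (Suc N)) + sqrt (real N))"
      by (simp add: algebra_simps)
    also have "\<dots> \<le> (sqrt (real (Suc N)) - sqrt (real N)) * (2 * sqrt (real (Suc N)))"
      by (intro mult_left_mono) auto
    finally show ?thesis by (simp add: field_simps)
  qed
  thus ?case using Suc by simp
qed simp

lemma ln_power2_le:
  fixes x :: real
  assumes "x \<ge> 1"
  shows "(ln x)\<^sup>2 \<le> 16 * sqrt x"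
proof -
  have "ln x \<le> 4 * x powr (1/4)" using ln_powr_bound[OF assms, of "1/4"] by simp
  hence "(ln x)\<^sup>2 \<le> (4 * x powr (1/4))\<^sup>2" using assms by (intro power_mono) auto
  also have "\<dots> = 16 * (x powr (1/4) * x powr (1/4))" by (simp add: power2_eq_square)
  also have "x powr (1/4) * x powr (1/4) = x powr (1/2)" by (simp flip: powr_add)
  finally show ?thesis using assms by (simp add: powr_half_sqrt)
qed

text \<open>The mean square of the weight that appears when \<open>ln N\<close> is replaced by
  \<open>ln n\<close>. It is bounded because the squared logarithm is dominated by a square root,
  whose sum over \<open>N / n\<close> is of order \<open>N\<close>.\<close>

lemma sum_power2_ln_quotient_le: "(\<Sum>n=1..N. (ln (real N / real n))\<^sup>2) \<le> 32 * real N"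
proof -
  have "(\<Sum>n=1..N. (ln (real N / real n))\<^sup>2) \<le> (\<Sum>n=1..N. 16 * sqrt (real N) * (1 / sqrt (real n)))"
  proof (rule sum_mono)
    fix n assume "n \<in> {1..N}"
    thus "(ln (real N / real n))\<^sup>2 \<le> 16 * sqrt (real N) * (1 / sqrt (real n))"
      using ln_power2_le[of "real N / real n"] by (simp add: real_sqrt_divide)
  qed
  also have "\<dots> = 16 * sqrt (real N) * (\<Sum>n=1..N. 1 / sqrt (real n))"
    by (simp add: sum_distrib_left)
  also have "\<dots> \<le> 16 * sqrt (real N) * (2 * sqrt (real N))"
    using sum_inverse_sqrt_le by (intro mult_left_mono) auto
  finally show ?thesis by simp
qed

section \<open>The powerful part of an integer\<close>

text \<open>The logarithm of the powerful part of \<open>n\<close>: the share of \<open>ln n\<close>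
  from primes at which \<open>n\<close> cannot be written as \<open>p * m\<close> with
  \<open>p\<close> and \<open>m\<close> coprime.\<close>

definition ln_squareful :: "nat \<Rightarrow> real" where
  "ln_squareful n = (\<Sum>p | p \<in> prime_factors n \<and> p\<^sup>2 dvd n. real (multiplicity p n) * ln (real p))"

lemma ln_squareful_nonneg: "0 \<le> ln_squareful n"
  unfolding ln_squareful_def
  by (intro sum_nonneg mult_nonneg_nonneg) (auto simp: in_prime_factors_imp_prime prime_gt_0_nat Suc_le_eq)

text \<open>A prime exponent \<open>v \<ge> 2\<close> satisfies \<open>v \<le> 3 * (v div 2)\<close>.\<close>

lemma ln_squareful_le:
  assumes "n > 0"
  shows "ln_squareful n \<le> 3 * ln (real (square_part n))"
proof -
  have pos: "square_part n > 0" by (rule gr0I) (use assms in simp)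
  have "ln_squareful n \<le> (\<Sum>p | p \<in> prime_factors n \<and> p\<^sup>2 dvd n.
      3 * (real (multiplicity p (square_part n)) * ln (real p)))"
    unfolding ln_squareful_def
  proof (rule sum_mono)
    fix p assume p: "p \<in> {p \<in> prime_factors n. p\<^sup>2 dvd n}"
    hence prime: "prime p" by blast
    hence "p \<noteq> 1" by auto
    with p have "2 \<le> multiplicity p n"
      using assms power_dvd_iff_le_multiplicity[of n p 2] by auto
    hence "multiplicity p n \<le> 3 * (multiplicity p n div 2)" by linarith
    also have "\<dots> = 3 * multiplicity p (square_part n)"
      using prime by (simp add: prime_multiplicity_square_part)
    finally have "real (multiplicity p n) \<le> 3 * real (multiplicity p (square_part n))" by linarith
    moreover have "0 \<le> ln (real p)"
      using p by (auto simp: in_prime_factors_imp_prime prime_gt_0_nat Suc_le_eq)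
    ultimately show "real (multiplicity p n) * ln (real p)
        \<le> 3 * (real (multiplicity p (square_part n)) * ln (real p))"
      using mult_right_mono[of _ _ "ln (real p)"] by (simp add: mult.assoc[symmetric])
  qed
  also have "\<dots> = 3 * (\<Sum>p | p \<in> prime_factors n \<and> p\<^sup>2 dvd n.
      real (multiplicity p (square_part n)) * ln (real p))"
    by (simp add: sum_distrib_left)
  also have "{p \<in> prime_factors n. p\<^sup>2 dvd n} = prime_factors (square_part n)"
  proof -
    have "p dvd n" if "p\<^sup>2 dvd n" for p
      by (rule dvd_trans[OF _ that]) simp
    thus ?thesis
      using assms pos by (auto simp: prime_factors_dvd dvd_square_part_iff)
  qed
  finally show ?thesis using ln_eq_sum_prime_factors[OF pos] by simp
qed

text \<open>With \<open>d = square_part n\<close> the summand is at most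
  \<open>9 * (ln d)\<^sup>2\<close> and \<open>d\<^sup>2 dvd n\<close>. Summing over every such
  \<open>d\<close> and exchanging the sums leaves \<open>N\<close> times a convergent
  series.\<close>

lemma sum_power2_ln_squareful_le:
  "\<exists>C\<ge>0. \<forall>N. (\<Sum>n=1..N. (ln_squareful n)\<^sup>2) \<le> C * real N"
proof (intro exI conjI allI)
  let ?c = "\<Sum>d. real d powr (-3/2)"
  have summ: "summable (\<lambda>d. real d powr (-3/2))" by (simp add: summable_real_powr_iff)
  show "0 \<le> 144 * ?c" using summ by (simp add: suminf_nonneg)
  fix N
  have "(\<Sum>n=1..N. (ln_squareful n)\<^sup>2) \<le> (\<Sum>n=1..N. \<Sum>d | d \<in> {1..N} \<and> d\<^sup>2 dvd n. 9 * (ln (real d))\<^sup>2)"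
  proof (rule sum_mono)
    fix n assume n: "n \<in> {1..N}"
    have s: "square_part n \<in> {d \<in> {1..N}. d\<^sup>2 dvd n}"
    proof -
      have "0 < square_part n" by (rule gr0I) (use n in simp)
      hence pos: "1 \<le> square_part n" by simp
      have "square_part n dvd n" by (rule dvd_trans[OF _ square_part_square_dvd]) simp
      hence "square_part n \<le> n" using n by (intro dvd_imp_le) auto
      thus ?thesis using pos n by auto
    qed
    have "(ln_squareful n)\<^sup>2 \<le> (3 * ln (real (square_part n)))\<^sup>2"
      using n by (intro power_mono ln_squareful_le ln_squareful_nonneg) auto
    also have "\<dots> = 9 * (ln (real (square_part n)))\<^sup>2" by (simp add: power_mult_distrib)
    \<comment> \<open>The single term at \<open>square_part n\<close> is bounded by the nonnegative
      sum over all \<open>d\<close>, which no longer depends on the square part.\<close>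
    also have "\<dots> \<le> (\<Sum>d | d \<in> {1..N} \<and> d\<^sup>2 dvd n. 9 * (ln (real d))\<^sup>2)"
      by (rule member_le_sum[OF s]) auto
    finally show "(ln_squareful n)\<^sup>2 \<le> (\<Sum>d | d \<in> {1..N} \<and> d\<^sup>2 dvd n. 9 * (ln (real d))\<^sup>2)" .
  qed
  also have "\<dots> = (\<Sum>d=1..N. \<Sum>n | n \<in> {1..N} \<and> d\<^sup>2 dvd n. 9 * (ln (real d))\<^sup>2)"
    by (rule sum.swap_restrict) auto
  also have "\<dots> = (\<Sum>d=1..N. real (N div d\<^sup>2) * (9 * (ln (real d))\<^sup>2))"
  proof (rule sum.cong)
    fix d assume "d \<in> {1..N}"
    thus "(\<Sum>n | n \<in> {1..N} \<and> d\<^sup>2 dvd n. 9 * (ln (real d))\<^sup>2) = real (N div d\<^sup>2) * (9 * (ln (real d))\<^sup>2)"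
      using card_multiples_eq[of "d\<^sup>2" N] by simp
  qed auto
  also have "\<dots> \<le> (\<Sum>d=1..N. 144 * real N * (real d powr (-3/2)))"
  proof (rule sum_mono)
    fix d assume d: "d \<in> {1..N}"
    have "real (N div d\<^sup>2) * (9 * (ln (real d))\<^sup>2) \<le> (real N / real (d\<^sup>2)) * (9 * (16 * sqrt (real d)))"
      using d by (intro mult_mono of_nat_div_le_of_nat ln_power2_le) auto
    also have "\<dots> = 144 * real N * (sqrt (real d) * inverse ((real d)\<^sup>2))"
      by (simp add: divide_inverse)
    also have "sqrt (real d) = real d powr (1/2)" by (simp add: powr_half_sqrt)
    also have "inverse ((real d)\<^sup>2) = real d powr (-2)"
      using d by (simp add: powr_minus)
    also have "real d powr (1/2) * real d powr (-2) = real d powr (-3/2)"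
      by (simp flip: powr_add)
    finally show "real (N div d\<^sup>2) * (9 * (ln (real d))\<^sup>2) \<le> 144 * real N * (real d powr (-3/2))" .
  qed
  also have "\<dots> = 144 * real N * (\<Sum>d=1..N. real d powr (-3/2))"
    by (simp add: sum_distrib_left)
  also have "\<dots> \<le> 144 * real N * ?c"
    using summ by (intro mult_left_mono sum_le_suminf) auto
  finally show "(\<Sum>n=1..N. (ln_squareful n)\<^sup>2) \<le> 144 * ?c * real N" by (simp add: mult_ac)
qed

lemma harm_le: "n \<ge> 1 \<Longrightarrow> harm n \<le> 1 + ln (real n)"
proof -
  assume "n \<ge> 1"
  then obtain k where "n = Suc k" by (cases n) auto
  thus ?thesis
    using decseqD[OF decseq_harm_diff_ln, of 0 k] by (simp add: harm_expand)
qed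

text \<open>Partial summation from \<open>FA_sum_le\<close>, arranged as an induction: passing from
  \<open>M\<close> to \<open>Suc M\<close> lowers the term \<open>F / M\<close> by at most
  \<open>A / Suc M\<close>, the next term of \<open>A * harm\<close>.\<close>

lemma FA_sum_over_le:
  assumes "f \<in> FA A" "A \<ge> 0" "M \<ge> 1"
  shows "(\<Sum>m=1..M. cmod (f m) / real m) \<le> A * (2 + ln (real M))"
proof -
  have partial: "(\<Sum>m=1..M. cmod (f m) / real m) \<le> (\<Sum>m=1..M. cmod (f m)) / real M + A * harm M"
    if "M \<ge> 1" for M using that
  proof (induction M rule: dec_induct)
    case base
    show ?case using assms by (simp add: harm_def)
  next
    case (step M)
    define F where "F = (\<Sum>m=1..M. cmod (f m))"
    have "F \<le> A * real M" unfolding F_def by (rule FA_sum_le[OF assms(1,2)])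
    hence "F / (real M * real (Suc M)) \<le> A / real (Suc M)"
      using step.hyps by (simp add: divide_le_eq mult_ac)
    moreover have "F / real M - F / real (Suc M) = F / (real M * real (Suc M))"
      using step.hyps by (simp add: diff_frac_eq algebra_simps)
    ultimately have "F / real M - F / real (Suc M) \<le> A / real (Suc M)" by simp
    hence "F / real M + A * harm M + cmod (f (Suc M)) / real (Suc M)
        \<le> (F + cmod (f (Suc M))) / real (Suc M) + A * harm (Suc M)"
      by (simp add: harm_Suc divide_inverse algebra_simps)
    with step.IH step.hyps show ?case by (simp add: F_def)
  qed
  have "(\<Sum>m=1..M. cmod (f m)) / real M \<le> A"
    using FA_sum_le[OF assms(1,2), of M] assms(3) by (simp add: pos_divide_le_eq)
  moreover have "A * harm M \<le> A * (1 + ln (real M))"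
    using assms by (intro mult_left_mono harm_le) auto
  ultimately show ?thesis using partial[OF assms(3)] by (simp add: algebra_simps)
qed

section \<open>Passage to a bilinear sum over primes\<close>

text \<open>Multiplicativity separates \<open>p\<close> from \<open>n div p\<close> only when
  \<open>p\<close> divides \<open>n\<close> exactly once; these primes are kept apart and the others
  go into \<open>ln_squareful\<close>.\<close>

lemma ln_split_exact_primes:
  assumes "n > 0"
  shows "ln (real n) = (\<Sum>p | prime p \<and> p dvd n \<and> \<not> p\<^sup>2 dvd n. ln (real p)) + ln_squareful n"
proof -
  have "ln (real n) = (\<Sum>p\<in>prime_factors n. real (multiplicity p n) * ln (real p))"
    by (rule ln_eq_sum_prime_factors[OF assms])
  also have "\<dots> = (\<Sum>p\<in>{p \<in> prime_factors n. \<not> p\<^sup>2 dvd n} \<union> {p \<in> prime_factors n. p\<^sup>2 dvd n}.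
      real (multiplicity p n) * ln (real p))"
    by (rule sum.cong) auto
  also have "\<dots> = (\<Sum>p | p \<in> prime_factors n \<and> \<not> p\<^sup>2 dvd n. real (multiplicity p n) * ln (real p))
      + ln_squareful n"
    unfolding ln_squareful_def by (rule sum.union_disjoint) auto
  also have "(\<Sum>p | p \<in> prime_factors n \<and> \<not> p\<^sup>2 dvd n. real (multiplicity p n) * ln (real p))
      = (\<Sum>p | prime p \<and> p dvd n \<and> \<not> p\<^sup>2 dvd n. ln (real p))"
  proof (rule sum.cong)
    show "{p \<in> prime_factors n. \<not> p\<^sup>2 dvd n} = {p. prime p \<and> p dvd n \<and> \<not> p\<^sup>2 dvd n}"
      using assms by (auto simp: prime_factors_dvd)
    fix p assume p: "p \<in> {p. prime p \<and> p dvd n \<and> \<not> p\<^sup>2 dvd n}"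
    hence "p \<noteq> 1" by auto
    with p have "\<not> 2 \<le> multiplicity p n" "1 \<le> multiplicity p n"
      using assms power_dvd_iff_le_multiplicity[of n p 2] power_dvd_iff_le_multiplicity[of n p 1] by auto
    hence "multiplicity p n = 1" by linarith
    thus "real (multiplicity p n) * ln (real p) = ln (real p)" by simp
  qed
  finally show ?thesis .
qed

text \<open>The hyperbolic bilinear form that \<open>ln N * (\<Sum>n=1..N. f n * g n)\<close> reduces to.\<close>

definition prime_bilinear :: "(nat \<Rightarrow> complex) \<Rightarrow> (nat \<Rightarrow> complex) \<Rightarrow> nat \<Rightarrow> complex" where
  "prime_bilinear f g N = (\<Sum>p | prime p \<and> p \<le> N. \<Sum>m=1..N div p.
     of_real (ln (real p)) * f p * f m * g (p * m))"

text \<open>For \<open>p\<close> dividing \<open>n\<close> exactly once, \<open>n = p * m\<close>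
  with \<open>m\<close> coprime to \<open>p\<close>, so \<open>f n = f p * f m\<close>. Adding and
  subtracting the terms with \<open>p dvd m\<close> turns the range of \<open>m\<close> into a full
  interval.\<close>

lemma sum_multiplicative_ln:
  assumes "multiplicative_fun f"
  shows "(\<Sum>n=1..N. f n * g n * of_real (ln (real n))) =
    prime_bilinear f g N
    - (\<Sum>p | prime p \<and> p \<le> N. \<Sum>m | m \<in> {1..N div p} \<and> p dvd m.
        of_real (ln (real p)) * f p * f m * g (p * m))
    + (\<Sum>n=1..N. f n * g n * of_real (ln_squareful n))"
proof -
  let ?P = "{p. prime p \<and> p \<le> N}"
  define t where "t = (\<lambda>p m. of_real (ln (real p)) * f p * f m * g (p * m))"
  have "(\<Sum>n=1..N. f n * g n * of_real (ln (real n))) =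
      (\<Sum>n=1..N. \<Sum>p | p \<in> ?P \<and> p dvd n \<and> \<not> p\<^sup>2 dvd n. f n * g n * of_real (ln (real p)))
      + (\<Sum>n=1..N. f n * g n * of_real (ln_squareful n))"
    unfolding sum.distrib[symmetric]
  proof (rule sum.cong[OF refl])
    fix n assume n: "n \<in> {1..N}"
    have P: "{p. p \<in> ?P \<and> p dvd n \<and> \<not> p\<^sup>2 dvd n} = {p. prime p \<and> p dvd n \<and> \<not> p\<^sup>2 dvd n}"
      using n by (auto dest: dvd_imp_le)
    show "f n * g n * of_real (ln (real n)) =
        (\<Sum>p | p \<in> ?P \<and> p dvd n \<and> \<not> p\<^sup>2 dvd n. f n * g n * of_real (ln (real p)))
        + f n * g n * of_real (ln_squareful n)"
      unfolding P using n
      by (subst ln_split_exact_primes) (simp_all add: distrib_left sum_distrib_left)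
  qed
  also have "(\<Sum>n=1..N. \<Sum>p | p \<in> ?P \<and> p dvd n \<and> \<not> p\<^sup>2 dvd n. f n * g n * of_real (ln (real p)))
      = (\<Sum>p\<in>?P. \<Sum>n | n \<in> {1..N} \<and> p dvd n \<and> \<not> p\<^sup>2 dvd n. f n * g n * of_real (ln (real p)))"
    by (rule sum.swap_restrict) auto
  also have "\<dots> = (\<Sum>p\<in>?P. (\<Sum>m=1..N div p. t p m) - (\<Sum>m | m \<in> {1..N div p} \<and> p dvd m. t p m))"
  proof (rule sum.cong[OF refl])
    fix p assume p: "p \<in> ?P"
    hence p0: "p > 0" "prime p" by (auto simp: prime_gt_0_nat)
    have "(\<Sum>n | n \<in> {1..N} \<and> p dvd n \<and> \<not> p\<^sup>2 dvd n. f n * g n * of_real (ln (real p)))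
        = (\<Sum>m | m \<in> {1..N div p} \<and> \<not> p dvd m. t p m)"
    proof (rule sum.reindex_bij_witness[of _ "\<lambda>m. p * m" "\<lambda>n. n div p"])
      fix n assume n: "n \<in> {n \<in> {1..N}. p dvd n \<and> \<not> p\<^sup>2 dvd n}"
      then obtain m where m: "n = p * m" by auto
      have m1: "\<not> p dvd m" using n m by (auto simp: power2_eq_square)
      have "1 \<le> m" using n m by (cases m) auto
      moreover have "m \<le> N div p"
        using n m p0 by (simp add: less_eq_div_iff_mult_less_eq mult.commute)
      ultimately show "n div p \<in> {m \<in> {1..N div p}. \<not> p dvd m}" using m p0 m1 by simp
      show "p * (n div p) = n" using n by auto
      have "coprime p m" using p0 m1 by (simp add: prime_imp_coprime)
      hence "f n = f p * f m" using assms m by (simp add: multiplicative_fun_def)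
      thus "t p (n div p) = f n * g n * of_real (ln (real p))"
        using m p0 by (simp add: t_def mult_ac)
    next
      fix m assume m: "m \<in> {m \<in> {1..N div p}. \<not> p dvd m}"
      show "p * m div p = m" using p0 by simp
      have "p * m \<le> N"
        using m p0 by (simp add: less_eq_div_iff_mult_less_eq mult.commute)
      thus "p * m \<in> {n \<in> {1..N}. p dvd n \<and> \<not> p\<^sup>2 dvd n}"
        using m p0 by (auto simp: power2_eq_square Suc_le_eq)
    qed
    also have "\<dots> = (\<Sum>m=1..N div p. t p m) - (\<Sum>m | m \<in> {1..N div p} \<and> p dvd m. t p m)"
    proof -
      have "(\<Sum>m=1..N div p. t p m) =
          (\<Sum>m\<in>{m \<in> {1..N div p}. \<not> p dvd m} \<union> {m \<in> {1..N div p}. p dvd m}. t p m)"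
        by (rule sum.cong) auto
      also have "\<dots> = (\<Sum>m | m \<in> {1..N div p} \<and> \<not> p dvd m. t p m)
          + (\<Sum>m | m \<in> {1..N div p} \<and> p dvd m. t p m)"
        by (rule sum.union_disjoint) auto
      finally show ?thesis by simp
    qed
    finally show "(\<Sum>n | n \<in> {1..N} \<and> p dvd n \<and> \<not> p\<^sup>2 dvd n. f n * g n * of_real (ln (real p)))
      = (\<Sum>m=1..N div p. t p m) - (\<Sum>m | m \<in> {1..N div p} \<and> p dvd m. t p m)" .
  qed
  finally show ?thesis
    by (simp add: prime_bilinear_def sum_subtractf t_def)
qed

lemma FA_prime_le: "f \<in> FA A \<Longrightarrow> prime p \<Longrightarrow> cmod (f p) \<le> A"
  by (simp add: FA_def)

lemma norm_prime_term_le: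
  assumes "f \<in> FA A" "prime p" "\<And>n. cmod (g n) \<le> \<tau>"
  shows "cmod (of_real (ln (real p)) * f p * f m * g (p * m)) \<le> \<tau> * (A * ln (real p)) * cmod (f m)"
proof -
  have l: "0 \<le> ln (real p)" using assms(2) by (simp add: prime_gt_0_nat Suc_le_eq)
  have "cmod (of_real (ln (real p)) * f p * f m * g (p * m)) =
      (ln (real p) * cmod (f p)) * (cmod (f m) * cmod (g (p * m)))"
    using l by (simp add: norm_mult)
  also have "\<dots> \<le> (ln (real p) * A) * (cmod (f m) * \<tau>)"
    using l assms(3) order_trans[OF norm_ge_zero FA_prime_le[OF assms(1,2)]]
    by (intro mult_mono mult_left_mono FA_prime_le[OF assms(1,2)]) auto
  finally show ?thesis by (simp add: mult_ac)
qed

text \<open>Controls the terms with \<open>p dvd m\<close>: the range of \<open>m\<close>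
  contributes \<open>1 / p\<close> and the multiples of \<open>p\<close> a further
  \<open>1 / sqrt p\<close>. A quarter power absorbs the logarithm.\<close>

lemma sum_ln_over_prime_powr_le:
  "\<exists>C\<ge>0. \<forall>N. (\<Sum>p | prime p \<and> p \<le> N. ln (real p) / (real p * sqrt (real p))) \<le> C"
proof (intro exI conjI allI)
  let ?c = "\<Sum>d. real d powr (-5/4)"
  have summ: "summable (\<lambda>d. real d powr (-5/4))" by (simp add: summable_real_powr_iff)
  show "0 \<le> 4 * ?c" using summ by (simp add: suminf_nonneg)
  fix N
  have "(\<Sum>p | prime p \<and> p \<le> N. ln (real p) / (real p * sqrt (real p)))
      \<le> (\<Sum>p | prime p \<and> p \<le> N. 4 * real p powr (-5/4))"
  proof (rule sum_mono)
    fix p assume "p \<in> {p. prime p \<and> p \<le> N}"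
    hence p: "real p \<ge> 1" by (auto simp: prime_gt_0_nat Suc_le_eq)
    have sq: "real p * sqrt (real p) = real p powr (3/2)"
    proof -
      have "real p powr (1 + 1/2) = real p powr 1 * real p powr (1/2)" by (rule powr_add)
      thus ?thesis using p by (simp add: powr_half_sqrt)
    qed
    have "ln (real p) / (real p * sqrt (real p)) \<le> 4 * real p powr (1/4) / (real p * sqrt (real p))"
      using ln_powr_bound[OF p, of "1/4"] by (intro divide_right_mono) auto
    also have "\<dots> = 4 * real p powr (-5/4)"
      unfolding sq times_divide_eq_right[symmetric] powr_diff[symmetric] by simp
    finally show "ln (real p) / (real p * sqrt (real p)) \<le> 4 * real p powr (-5/4)" .
  qed
  also have "\<dots> = 4 * (\<Sum>p | prime p \<and> p \<le> N. real p powr (-5/4))"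
    by (simp add: sum_distrib_left)
  also have "\<dots> \<le> 4 * ?c"
    using summ by (intro mult_left_mono sum_le_suminf) auto
  finally show "(\<Sum>p | prime p \<and> p \<le> N. ln (real p) / (real p * sqrt (real p))) \<le> 4 * ?c" .
qed

text \<open>There are three errors: \<open>E1\<close> from \<open>ln (N / n)\<close>,
  \<open>E2\<close> from the powerful part and \<open>E3\<close> from \<open>p dvd m\<close>. All
  are linear in \<open>N\<close> by Cauchy--Schwarz and use only the size of \<open>g\<close>, so
  \<open>C\<close> is absolute.\<close>

lemma ln_times_sum_approx:
  "\<exists>C\<ge>0. \<forall>A\<ge>1. \<forall>f\<in>FA A. \<forall>g \<tau> N. (\<forall>n. cmod (g n) \<le> \<tau>) \<longrightarrow>
     cmod (of_real (ln (real N)) * (\<Sum>n=1..N. f n * g n) - prime_bilinear f g N)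
       \<le> C * \<tau> * A\<^sup>2 * real N"
proof -
  obtain C1 where C1: "C1 \<ge> 0" "\<And>N. (\<Sum>n=1..N. (ln_squareful n)\<^sup>2) \<le> C1 * real N"
    using sum_power2_ln_squareful_le by blast
  obtain C2 where C2: "C2 \<ge> 0"
    "\<And>N. (\<Sum>p | prime p \<and> p \<le> N. ln (real p) / (real p * sqrt (real p))) \<le> C2"
    using sum_ln_over_prime_powr_le by blast
  show ?thesis
  proof (intro exI[of _ "sqrt 32 + sqrt C1 + C2"] conjI allI ballI impI)
    show "0 \<le> sqrt 32 + sqrt C1 + C2" using C1 C2 by simp
    fix A :: real and f g :: "nat \<Rightarrow> complex" and \<tau> N
    assume A: "1 \<le> A" and f: "f \<in> FA A" and g: "\<forall>n. cmod (g n) \<le> \<tau>"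
    have \<tau>: "0 \<le> \<tau>" using g norm_ge_zero order_trans by blast
    have AA: "A \<le> A\<^sup>2" using A by (simp add: power2_eq_square)
    define E1 where "E1 = (\<Sum>n=1..N. f n * g n * of_real (ln (real N / real n)))"
    define E2 where "E2 = (\<Sum>n=1..N. f n * g n * of_real (ln_squareful n))"
    define E3 where "E3 = (\<Sum>p | prime p \<and> p \<le> N. \<Sum>m | m \<in> {1..N div p} \<and> p dvd m.
        of_real (ln (real p)) * f p * f m * g (p * m))"
    have weighted: "cmod (\<Sum>n=1..N. f n * g n * of_real (h n)) \<le> \<tau> * (A * sqrt C * real N)"
      if h: "\<And>n. 0 \<le> h n" and C: "(\<Sum>n=1..N. (h n)\<^sup>2) \<le> C * real N" for h C
    proof -
      have "cmod (\<Sum>n=1..N. f n * g n * of_real (h n)) \<le> (\<Sum>n=1..N. \<tau> * (cmod (f n) * h n))"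
      proof (rule order_trans[OF norm_sum sum_mono])
        fix n
        have "cmod (f n * g n * of_real (h n)) = cmod (g n) * (cmod (f n) * h n)"
          using h[of n] by (simp add: norm_mult)
        also have "\<dots> \<le> \<tau> * (cmod (f n) * h n)"
          using h[of n] g by (intro mult_right_mono) auto
        finally show "cmod (f n * g n * of_real (h n)) \<le> \<tau> * (cmod (f n) * h n)" .
      qed
      also have "\<dots> = \<tau> * (\<Sum>n=1..N. cmod (f n) * h n)" by (simp add: sum_distrib_left)
      also have "\<dots> \<le> \<tau> * (A * sqrt C * real N)"
        using A h \<tau> by (intro mult_left_mono FA_cauchy'[OF f] C) auto
      finally show ?thesis .
    qed
    \<comment> \<open>The bound \<open>weighted\<close> asks for a weight that is nonnegative at
      every \<open>n\<close>, while \<open>ln (N / n)\<close> is negative beyond \<open>N\<close>;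
      on the range of summation the absolute value changes nothing.\<close>
    have "E1 = (\<Sum>n=1..N. f n * g n * of_real \<bar>ln (real N / real n)\<bar>)"
      unfolding E1_def by (intro sum.cong) auto
    hence E1: "cmod E1 \<le> \<tau> * (A * sqrt 32 * real N)"
      using weighted[of "\<lambda>n. \<bar>ln (real N / real n)\<bar>" 32] sum_power2_ln_quotient_le[of N] by simp
    have E2: "cmod E2 \<le> \<tau> * (A * sqrt C1 * real N)"
      unfolding E2_def by (rule weighted[OF ln_squareful_nonneg C1(2)])
    have E3: "cmod E3 \<le> \<tau> * (A\<^sup>2 * C2 * real N)"
    proof -
      have "cmod E3 \<le> (\<Sum>p | prime p \<and> p \<le> N. \<tau> * A\<^sup>2 * real N * (ln (real p) / (real p * sqrt (real p))))"
        unfolding E3_def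
      proof (rule order_trans[OF norm_sum sum_mono])
        fix p assume p: "p \<in> {p. prime p \<and> p \<le> N}"
        hence p0: "prime p" "p > 0" by (auto simp: prime_gt_0_nat)
        have l: "0 \<le> ln (real p)" using p0 by (simp add: Suc_le_eq)
        have "cmod (\<Sum>m | m \<in> {1..N div p} \<and> p dvd m. of_real (ln (real p)) * f p * f m * g (p * m))
            \<le> (\<Sum>m | m \<in> {1..N div p} \<and> p dvd m. \<tau> * (A * ln (real p)) * cmod (f m))"
          using f p0 g by (intro order_trans[OF norm_sum sum_mono] norm_prime_term_le) auto
        also have "\<dots> = \<tau> * (A * ln (real p)) * (\<Sum>m | m \<in> {1..N div p} \<and> p dvd m. cmod (f m))"
          by (simp add: sum_distrib_left)
        also have "\<dots> \<le> \<tau> * (A * ln (real p)) * (A * real (N div p) / sqrt (real p))"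
          using \<tau> A l p0 by (intro mult_left_mono FA_sum_multiples_le[OF f]) auto
        also have "\<dots> \<le> \<tau> * (A * ln (real p)) * (A * (real N / real p) / sqrt (real p))"
          using \<tau> A l by (intro mult_left_mono divide_right_mono of_nat_div_le_of_nat) auto
        also have "\<dots> = \<tau> * A\<^sup>2 * real N * (ln (real p) / (real p * sqrt (real p)))"
          by (simp add: power2_eq_square)
        finally show "cmod (\<Sum>m | m \<in> {1..N div p} \<and> p dvd m. of_real (ln (real p)) * f p * f m * g (p * m))
            \<le> \<tau> * A\<^sup>2 * real N * (ln (real p) / (real p * sqrt (real p)))" .
      qed
      also have "\<dots> = \<tau> * A\<^sup>2 * real N * (\<Sum>p | prime p \<and> p \<le> N. ln (real p) / (real p * sqrt (real p)))"
        by (simp add: sum_distrib_left)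
      also have "\<dots> \<le> \<tau> * A\<^sup>2 * real N * C2"
        using \<tau> by (intro mult_left_mono C2) auto
      finally show ?thesis by (simp add: mult_ac)
    qed
    have "of_real (ln (real N)) * (\<Sum>n=1..N. f n * g n) = E1 + (\<Sum>n=1..N. f n * g n * of_real (ln (real n)))"
      unfolding E1_def sum_distrib_left sum.distrib[symmetric]
    proof (rule sum.cong[OF refl])
      fix n assume "n \<in> {1..N}"
      hence "ln (real N) = ln (real N / real n) + ln (real n)" by (simp add: ln_div)
      hence "complex_of_real (ln (real N)) = of_real (ln (real N / real n)) + of_real (ln (real n))"
        by (metis of_real_add)
      thus "of_real (ln (real N)) * (f n * g n) =
          f n * g n * of_real (ln (real N / real n)) + f n * g n * of_real (ln (real n))"
        by (simp only:) (simp only: algebra_simps)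
    qed
    also have "(\<Sum>n=1..N. f n * g n * of_real (ln (real n))) = prime_bilinear f g N - E3 + E2"
      unfolding E2_def E3_def using f by (intro sum_multiplicative_ln) (simp add: FA_def)
    finally have "of_real (ln (real N)) * (\<Sum>n=1..N. f n * g n) - prime_bilinear f g N = E1 - E3 + E2"
      by simp
    hence "cmod (of_real (ln (real N)) * (\<Sum>n=1..N. f n * g n) - prime_bilinear f g N)
        \<le> cmod E1 + cmod E3 + cmod E2"
      by (metis (no_types, lifting) norm_triangle_ineq norm_triangle_ineq4 add_right_mono order_trans)
    also have "\<dots> \<le> \<tau> * (A\<^sup>2 * sqrt 32 * real N) + \<tau> * (A\<^sup>2 * C2 * real N) + \<tau> * (A\<^sup>2 * sqrt C1 * real N)"
    proof (intro add_mono E3)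
      show "cmod E1 \<le> \<tau> * (A\<^sup>2 * sqrt 32 * real N)"
        using AA \<tau> by (intro order_trans[OF E1] mult_left_mono mult_right_mono) auto
      show "cmod E2 \<le> \<tau> * (A\<^sup>2 * sqrt C1 * real N)"
        using AA \<tau> C1 by (intro order_trans[OF E2] mult_left_mono mult_right_mono) auto
    qed
    finally show "cmod (of_real (ln (real N)) * (\<Sum>n=1..N. f n * g n) - prime_bilinear f g N)
       \<le> (sqrt 32 + sqrt C1 + C2) * \<tau> * A\<^sup>2 * real N"
      by (simp add: algebra_simps)
  qed
qed

subsection \<open>Ranges of the bilinear form\<close>

definition prime_term :: "(nat \<Rightarrow> complex) \<Rightarrow> (nat \<Rightarrow> complex) \<Rightarrow> nat \<Rightarrow> nat \<Rightarrow> complex" where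
  "prime_term f g p m = of_real (ln (real p)) * f p * f m * g (p * m)"

text \<open>Summing over \<open>p\<close> first, Chebyshev's bound gives \<open>4 * N / m\<close>
  for each \<open>m\<close>; the sum of \<open>cmod (f m) / m\<close> then costs only
  \<open>ln M\<close>.\<close>

lemma norm_sum_small_m_le:
  assumes f: "f \<in> FA A" and A: "A \<ge> 1" and g: "\<And>n. cmod (g n) \<le> \<tau>" and "M \<ge> 1"
  shows "cmod (\<Sum>p | prime p \<and> p \<le> N. \<Sum>m | m \<in> {1..M} \<and> p * m \<le> N. prime_term f g p m)
    \<le> 4 * \<tau> * A\<^sup>2 * real N * (2 + ln (real M))"
proof -
  have \<tau>: "0 \<le> \<tau>" using g norm_ge_zero order_trans by blast
  have "cmod (\<Sum>p | prime p \<and> p \<le> N. \<Sum>m | m \<in> {1..M} \<and> p * m \<le> N. prime_term f g p m)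
      \<le> (\<Sum>p | prime p \<and> p \<le> N. \<Sum>m | m \<in> {1..M} \<and> p * m \<le> N. \<tau> * (A * ln (real p)) * cmod (f m))"
    unfolding prime_term_def
    by (intro order_trans[OF norm_sum sum_mono] norm_prime_term_le f g) auto
  also have "\<dots> = (\<Sum>m=1..M. \<Sum>p | p \<in> {p. prime p \<and> p \<le> N} \<and> p * m \<le> N. \<tau> * (A * ln (real p)) * cmod (f m))"
    by (rule sum.swap_restrict) auto
  also have "\<dots> \<le> (\<Sum>m=1..M. 4 * \<tau> * A * real N * (cmod (f m) / real m))"
  proof (rule sum_mono)
    fix m assume m: "m \<in> {1..M}"
    have "{p. p \<in> {p. prime p \<and> p \<le> N} \<and> p * m \<le> N} = {p. prime p \<and> p \<le> N div m}"
    proof -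
      have "p * m \<le> N \<longleftrightarrow> p \<le> N div m" for p
        using m by (simp add: less_eq_div_iff_mult_less_eq)
      moreover have "N div m \<le> N" by simp
      ultimately show ?thesis by (auto intro: order_trans)
    qed
    hence "(\<Sum>p | p \<in> {p. prime p \<and> p \<le> N} \<and> p * m \<le> N. \<tau> * (A * ln (real p)) * cmod (f m))
        = (\<tau> * A * cmod (f m)) * (\<Sum>p | prime p \<and> p \<le> N div m. ln (real p))"
      by (simp add: sum_distrib_left mult_ac)
    also have "\<dots> \<le> (\<tau> * A * cmod (f m)) * (4 * real (N div m))"
      using \<tau> A by (intro mult_left_mono chebyshev_theta_le) auto
    also have "\<dots> \<le> (\<tau> * A * cmod (f m)) * (4 * (real N / real m))"
      using \<tau> A by (intro mult_left_mono of_nat_div_le_of_nat) auto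
    finally show "(\<Sum>p | p \<in> {p. prime p \<and> p \<le> N} \<and> p * m \<le> N. \<tau> * (A * ln (real p)) * cmod (f m))
        \<le> 4 * \<tau> * A * real N * (cmod (f m) / real m)" by (simp add: mult_ac)
  qed
  also have "\<dots> = 4 * \<tau> * A * real N * (\<Sum>m=1..M. cmod (f m) / real m)"
    by (simp add: sum_distrib_left)
  also have "\<dots> \<le> 4 * \<tau> * A * real N * (A * (2 + ln (real M)))"
    using \<tau> A \<open>M \<ge> 1\<close> by (intro mult_left_mono FA_sum_over_le f) auto
  finally show ?thesis by (simp add: power2_eq_square mult_ac)
qed

text \<open>Summing over \<open>m\<close> first gives \<open>A * N / p\<close> for each
  \<open>p\<close>, and the sum of \<open>ln p / p\<close> costs only \<open>ln P\<close>.\<close>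

lemma norm_sum_small_p_le:
  assumes f: "f \<in> FA A" and A: "A \<ge> 1" and g: "\<And>n. cmod (g n) \<le> \<tau>" and "P \<ge> 1"
  shows "cmod (\<Sum>p | prime p \<and> p \<le> P. \<Sum>m\<in>{M<..N div p}. prime_term f g p m)
    \<le> \<tau> * A\<^sup>2 * real N * (ln (real P) + 4)"
proof -
  have \<tau>: "0 \<le> \<tau>" using g norm_ge_zero order_trans by blast
  have "cmod (\<Sum>p | prime p \<and> p \<le> P. \<Sum>m\<in>{M<..N div p}. prime_term f g p m)
      \<le> (\<Sum>p | prime p \<and> p \<le> P. \<tau> * A\<^sup>2 * real N * (ln (real p) / real p))"
  proof (rule order_trans[OF norm_sum sum_mono])
    fix p assume "p \<in> {p. prime p \<and> p \<le> P}"
    hence p: "prime p" "p > 0" "0 \<le> ln (real p)" by (auto simp: prime_gt_0_nat Suc_le_eq)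
    have "cmod (\<Sum>m\<in>{M<..N div p}. prime_term f g p m)
        \<le> (\<Sum>m\<in>{M<..N div p}. \<tau> * (A * ln (real p)) * cmod (f m))"
      unfolding prime_term_def
      by (intro order_trans[OF norm_sum sum_mono] norm_prime_term_le f g p)
    also have "\<dots> \<le> (\<Sum>m=1..N div p. \<tau> * (A * ln (real p)) * cmod (f m))"
      using \<tau> A p by (intro sum_mono2) auto
    also have "\<dots> = \<tau> * (A * ln (real p)) * (\<Sum>m=1..N div p. cmod (f m))"
      by (simp add: sum_distrib_left)
    also have "\<dots> \<le> \<tau> * (A * ln (real p)) * (A * real (N div p))"
      using \<tau> A p by (intro mult_left_mono FA_sum_le[OF f]) auto
    also have "\<dots> \<le> \<tau> * (A * ln (real p)) * (A * (real N / real p))"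
      using \<tau> A p by (intro mult_left_mono of_nat_div_le_of_nat) auto
    finally show "cmod (\<Sum>m\<in>{M<..N div p}. prime_term f g p m)
        \<le> \<tau> * A\<^sup>2 * real N * (ln (real p) / real p)" by (simp add: power2_eq_square mult_ac)
  qed
  also have "\<dots> = \<tau> * A\<^sup>2 * real N * (\<Sum>p | prime p \<and> p \<le> P. ln (real p) / real p)"
    by (simp add: sum_distrib_left)
  also have "\<dots> \<le> \<tau> * A\<^sup>2 * real N * (ln (real P) + 4)"
    using \<tau> A \<open>P \<ge> 1\<close> by (intro mult_left_mono sum_ln_over_primes_le) auto
  finally show ?thesis .
qed

text \<open>Makes \<open>bilinear_block\<close> uniform in \<open>P\<close>: as
  \<open>(N div P) * P \<le> N\<close>, each of its error terms is at most \<open>N\<close> times a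
  quantity free of \<open>P\<close>. Zero values of \<open>a\<close> off the primes let the block
  run over all integers.\<close>

lemma norm_prime_block_le:
  fixes f :: "nat \<Rightarrow> complex" and P M N L :: nat and \<omega> \<delta> A :: real
  assumes sep: "\<And>h. 1 \<le> h \<Longrightarrow> h < L \<Longrightarrow> \<delta> \<le> dist_nint (real h * \<omega>)"
    and "L \<ge> 1" and "\<delta> > 0" and P: "P \<ge> Q" "Q \<ge> 1" and M: "M \<ge> 1"
    and f: "f \<in> FA A" and A: "A \<ge> 1"
    and a: "\<And>p. a p = (if prime p \<and> p \<le> N then of_real (ln (real p)) * f p else 0)"
  shows "cmod (\<Sum>p\<in>{P<..P + P}. \<Sum>m\<in>{M<..N div p}. a p * f m * cis (2 * pi * (real (p * m) * \<omega>)))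
    \<le> A\<^sup>2 * ln (real N) * real N * sqrt (1 / real L + 1 / real Q + 2 / (real M * \<delta>))" (is "cmod ?S \<le> _")
proof (cases "M \<le> N div P")
  case False
  \<comment> \<open>If \<open>M\<close> exceeds \<open>N div P\<close>, no \<open>m\<close> is left.
    In the other case \<open>P * M \<le> N\<close>, which is what controls the term with
    \<delta>.\<close>
  have empty: "{M<..N div p} = {}" if "p \<in> {P<..P + P}" for p
  proof -
    have "N div p \<le> N div P" using that P by (intro div_le_mono2) auto
    thus ?thesis using False by auto
  qed
  hence S0: "?S = 0" by (intro sum.neutral ballI) (use empty in blast)
  have "0 \<le> ln (real N)" by (cases "N = 0") auto
  thus ?thesis unfolding S0 using \<open>\<delta> > 0\<close> by simp
next
  case True
  define X where "X = N div P"
  define R where "R = 1 / real L + 1 / real Q + 2 / (real M * \<delta>)"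
  have pos: "0 < real P" "0 < real X" "0 < real M" "0 < real L" "0 < real Q"
    using P True M \<open>L \<ge> 1\<close> by (auto simp: X_def)
  have "X * P \<le> N" by (simp add: X_def)
  hence XP: "real X * real P \<le> real N" using of_nat_mono[OF \<open>X * P \<le> N\<close>, where ?'a = real] by simp
  have "N > 0" using True M by (cases "N = 0") auto
  hence lnN: "0 \<le> ln (real N)" by simp
  have a_le: "cmod (a p) \<le> A * ln (real N)" for p
  proof (cases "prime p \<and> p \<le> N")
    case True
    hence "0 < p" "p \<le> N" by (auto simp: prime_gt_0_nat)
    hence "0 \<le> ln (real p)" "ln (real p) \<le> ln (real N)" by (auto simp: Suc_le_eq)
    hence "ln (real p) * cmod (f p) \<le> ln (real N) * A"
      using True by (intro mult_mono FA_prime_le[OF f]) auto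
    thus ?thesis using True \<open>0 \<le> ln (real p)\<close> by (simp add: a norm_mult mult.commute)
  next
    case False
    hence "a p = 0" by (auto simp: a)
    thus ?thesis using lnN A by simp
  qed
  have sumf: "(\<Sum>m=1..X. (cmod (f m))\<^sup>2) \<le> A\<^sup>2 * real X"
    using f by (simp add: FA_def)
  have "(cmod ?S)\<^sup>2 \<le> (\<Sum>m=1..X. (cmod (f m))\<^sup>2) *
      ((A * ln (real N))\<^sup>2 * real P * (real X * (real P / real L + 1) + real P * (2 / \<delta>)))"
    unfolding X_def by (rule bilinear_block[OF sep \<open>L \<ge> 1\<close> \<open>\<delta> > 0\<close> _ a_le]) (use P in auto)
  also have "\<dots> \<le> (A\<^sup>2 * real X) *
      ((A * ln (real N))\<^sup>2 * real P * (real X * (real P / real L + 1) + real P * (2 / \<delta>)))"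
    using \<open>\<delta> > 0\<close> by (intro mult_right_mono sumf mult_nonneg_nonneg add_nonneg_nonneg) auto
  also have "\<dots> = (A\<^sup>2 * ln (real N))\<^sup>2 * (real X * real P) *
      (real X * real P / real L + real X + real P * (2 / \<delta>))"
    by (simp add: power2_eq_square algebra_simps)
  also have "\<dots> \<le> (A\<^sup>2 * ln (real N))\<^sup>2 * real N * (real N * R)"
  proof (intro mult_mono mult_left_mono XP)
    have "real X * real P / real L \<le> real N * (1 / real L)"
      using XP pos by (simp add: divide_right_mono)
    moreover have "real X \<le> real N * (1 / real Q)"
    proof -
      have "real X * real Q \<le> real X * real P" using P by (intro mult_left_mono) auto
      hence "real X * real Q \<le> real N" using XP by (rule order_trans)
      thus ?thesis using pos by (simp add: le_divide_eq)
    qed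
    moreover have "real P * (2 / \<delta>) \<le> real N * (2 / (real M * \<delta>))"
    proof -
      have "real P * real M \<le> real P * real X" using True by (intro mult_left_mono) (auto simp: X_def)
      hence "real P * real M \<le> real N" using XP by (simp add: mult.commute)
      thus ?thesis using pos \<open>\<delta> > 0\<close> by (simp add: field_simps)
    qed
    ultimately show "real X * real P / real L + real X + real P * (2 / \<delta>) \<le> real N * R"
      unfolding R_def distrib_left by linarith
  qed (use \<open>\<delta> > 0\<close> in auto)
  also have "\<dots> = (A\<^sup>2 * ln (real N) * real N * sqrt R)\<^sup>2"
  proof -
    have "0 \<le> R" using \<open>\<delta> > 0\<close> by (simp add: R_def)
    thus ?thesis by (simp add: power_mult_distrib power2_eq_square mult_ac)
  qed
  finally show ?thesis
    unfolding R_def[symmetric]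
    by (rule power2_le_imp_le) (use lnN \<open>\<delta> > 0\<close> in \<open>auto simp: R_def\<close>)
qed

text \<open>\<open>J\<close> dyadic blocks starting at \<open>Q\<close> cover all primes up to
  \<open>N\<close>, and each costs the same.\<close>

lemma norm_prime_large_le:
  fixes f :: "nat \<Rightarrow> complex" and Q M N L J :: nat and \<omega> \<delta> A :: real
  assumes sep: "\<And>h. 1 \<le> h \<Longrightarrow> h < L \<Longrightarrow> \<delta> \<le> dist_nint (real h * \<omega>)"
    and "L \<ge> 1" and "\<delta> > 0" and "Q \<ge> 1" and "M \<ge> 1"
    and f: "f \<in> FA A" and "A \<ge> 1" and J: "N \<le> 2 ^ J * Q"
  shows "cmod (\<Sum>p | prime p \<and> p \<in> {Q<..N}. \<Sum>m\<in>{M<..N div p}.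
      prime_term f (\<lambda>n. cis (2 * pi * (real n * \<omega>))) p m)
    \<le> real J * (A\<^sup>2 * ln (real N) * real N * sqrt (1 / real L + 1 / real Q + 2 / (real M * \<delta>)))"
proof -
  define a where "a = (\<lambda>p. if prime p \<and> p \<le> N then of_real (ln (real p)) * f p else 0)"
  define B where "B = A\<^sup>2 * ln (real N) * real N * sqrt (1 / real L + 1 / real Q + 2 / (real M * \<delta>))"
  define s where "s = (\<lambda>p. \<Sum>m\<in>{M<..N div p}. a p * f m * cis (2 * pi * (real (p * m) * \<omega>)))"
  have "cmod (\<Sum>p\<in>{Q<..2 ^ J * Q}. s p) \<le> real J * B" for J
  proof (induction J)
    case (Suc J)
    define R where "R = 2 ^ J * Q"
    have R: "Q \<le> R" "2 ^ Suc J * Q = R + R" by (auto simp: R_def)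
    have "{Q<..R + R} = {Q<..R} \<union> {R<..R + R}" using R(1) by auto
    hence "(\<Sum>p\<in>{Q<..R + R}. s p) = (\<Sum>p\<in>{Q<..R}. s p) + (\<Sum>p\<in>{R<..R + R}. s p)"
      by (simp only:) (rule sum.union_disjoint, auto)
    moreover have "cmod (\<Sum>p\<in>{R<..R + R}. s p) \<le> B"
      unfolding s_def B_def
      by (rule norm_prime_block_le[OF sep]) (use assms R(1) in \<open>auto simp: a_def\<close>)
    ultimately have "cmod (\<Sum>p\<in>{Q<..2 ^ Suc J * Q}. s p) \<le> real J * B + B"
      using Suc.IH unfolding R(2) by (simp add: norm_triangle_mono R_def)
    thus ?case by (simp add: algebra_simps)
  qed simp
  from this[of J] have "cmod (\<Sum>p\<in>{Q<..2 ^ J * Q}. s p) \<le> real J * B" .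
  \<comment> \<open>The last block may reach beyond \<open>N\<close>; there, as at nonprimes,
    \<open>a\<close> vanishes.\<close>
  also have "(\<Sum>p\<in>{Q<..2 ^ J * Q}. s p) = (\<Sum>p | prime p \<and> p \<in> {Q<..N}. s p)"
    by (rule sum.mono_neutral_right) (use J in \<open>auto simp: s_def a_def\<close>)
  also have "\<dots> = (\<Sum>p | prime p \<and> p \<in> {Q<..N}. \<Sum>m\<in>{M<..N div p}.
      prime_term f (\<lambda>n. cis (2 * pi * (real n * \<omega>))) p m)"
    by (intro sum.cong refl) (auto simp: s_def a_def prime_term_def)
  finally show ?thesis by (simp add: B_def)
qed

text \<open>Pairs with \<open>m \<le> M\<close> are removed first, for all \<open>p\<close>; the
  rest is divided at \<open>p = Q\<close>.\<close>

lemma prime_bilinear_split: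
  "prime_bilinear f g N =
    (\<Sum>p | prime p \<and> p \<le> N. \<Sum>m | m \<in> {1..M} \<and> p * m \<le> N. prime_term f g p m)
    + (\<Sum>p | prime p \<and> p \<le> Q. \<Sum>m\<in>{M<..N div p}. prime_term f g p m)
    + (\<Sum>p | prime p \<and> p \<in> {Q<..N}. \<Sum>m\<in>{M<..N div p}. prime_term f g p m)"
proof -
  have "prime_bilinear f g N = (\<Sum>p | prime p \<and> p \<le> N.
      (\<Sum>m | m \<in> {1..M} \<and> p * m \<le> N. prime_term f g p m) + (\<Sum>m\<in>{M<..N div p}. prime_term f g p m))"
    unfolding prime_bilinear_def prime_term_def[symmetric]
  proof (rule sum.cong[OF refl])
    fix p assume "p \<in> {p. prime p \<and> p \<le> N}"
    hence "p > 0" by (auto simp: prime_gt_0_nat)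
    hence "p * m \<le> N \<longleftrightarrow> m \<le> N div p" for m
      by (simp add: less_eq_div_iff_mult_less_eq mult.commute)
    hence "{m. m \<in> {1..M} \<and> p * m \<le> N} = {m. m \<in> {1..M} \<and> m \<le> N div p}"
      by (simp only:)
    moreover have "(\<Sum>m=1..n. prime_term f g p m) =
        (\<Sum>m | m \<in> {1..M} \<and> m \<le> n. prime_term f g p m) + (\<Sum>m\<in>{M<..n}. prime_term f g p m)" for n
    proof -
      have "{1..n} = {m. m \<in> {1..M} \<and> m \<le> n} \<union> {M<..n}" by auto
      thus ?thesis by (simp only:) (rule sum.union_disjoint, auto)
    qed
    ultimately show "(\<Sum>m=1..N div p. prime_term f g p m) =
        (\<Sum>m | m \<in> {1..M} \<and> p * m \<le> N. prime_term f g p m) + (\<Sum>m\<in>{M<..N div p}. prime_term f g p m)"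
      by (simp only:)
  qed
  also have "\<dots> = (\<Sum>p | prime p \<and> p \<le> N. \<Sum>m | m \<in> {1..M} \<and> p * m \<le> N. prime_term f g p m)
      + (\<Sum>p | prime p \<and> p \<le> N. \<Sum>m\<in>{M<..N div p}. prime_term f g p m)"
    by (rule sum.distrib)
  also have "(\<Sum>p | prime p \<and> p \<le> N. \<Sum>m\<in>{M<..N div p}. prime_term f g p m)
     = (\<Sum>p | prime p \<and> p \<le> Q. \<Sum>m\<in>{M<..N div p}. prime_term f g p m)
     + (\<Sum>p | prime p \<and> p \<in> {Q<..N}. \<Sum>m\<in>{M<..N div p}. prime_term f g p m)"
  proof -
    define G where "G = (\<lambda>p. \<Sum>m\<in>{M<..N div p}. prime_term f g p m)"
    \<comment> \<open>\<open>Q\<close> may exceed \<open>N\<close>; for \<open>p > N\<close> the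
      inner range is empty, so the surplus primes contribute nothing.\<close>
    have G0: "p \<le> N" if "G p \<noteq> 0" for p
      by (rule ccontr) (use that in \<open>simp add: G_def\<close>)
    have "sum G {p. prime p \<and> p \<le> N} = sum G ({p. prime p \<and> p \<le> Q} \<union> {p. prime p \<and> p \<in> {Q<..N}})"
      by (rule sum.mono_neutral_left) (use G0 in auto)
    also have "\<dots> = sum G {p. prime p \<and> p \<le> Q} + sum G {p. prime p \<and> p \<in> {Q<..N}}"
      by (rule sum.union_disjoint) auto
    finally show ?thesis unfolding G_def .
  qed
  finally show ?thesis by (simp only: add.assoc)
qed

subsection \<open>Beatty sequences\<close>

text \<open>With \<open>y = (\<beta> - n) * \<theta>\<close>, this is the Fourier partial sum of
  length \<open>K\<close> of \<open>frac (y - \<theta>) - frac y\<close>.\<close>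

definition beatty_poly :: "real \<Rightarrow> real \<Rightarrow> nat \<Rightarrow> nat \<Rightarrow> real" where
  "beatty_poly \<theta> \<beta> K n = (\<Sum>k=1..K. (sin (2 * pi * real k * ((\<beta> - real n) * \<theta>))
     - sin (2 * pi * real k * ((\<beta> - real n) * \<theta> - \<theta>))) / (pi * real k))"

lemma beatty_poly_eq:
  "beatty_poly \<theta> \<beta> K n = saw_err K ((\<beta> - real n) * \<theta>) - saw_err K ((\<beta> - real n) * \<theta> - \<theta>)
     + (frac ((\<beta> - real n) * \<theta> - \<theta>) - frac ((\<beta> - real n) * \<theta>))"
  unfolding saw_err_def beatty_poly_def by (simp add: sum_subtractf diff_divide_distrib)

text \<open>Termwise estimation would lose a factor \<open>ln K\<close>. Uniformity in
  \<open>K\<close> comes from two sawtooth errors of size at most 2 and a difference of fractional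
  parts of size at most 1.\<close>

lemma abs_beatty_poly_le: "\<bar>beatty_poly \<theta> \<beta> K n\<bar> \<le> 5"
proof -
  have "\<bar>frac x - frac y\<bar> \<le> 1" for x y :: real
    using frac_ge_0[of x] frac_lt_1[of x] frac_ge_0[of y] frac_lt_1[of y] by linarith
  from this[of "(\<beta> - real n) * \<theta> - \<theta>" "(\<beta> - real n) * \<theta>"] show ?thesis
    using saw_err_le(1)[of K "(\<beta> - real n) * \<theta> - \<theta>"] saw_err_le(1)[of K "(\<beta> - real n) * \<theta>"]
    unfolding beatty_poly_eq by linarith
qed

text \<open>Membership means that an integer lies in the half-open interval from
  \<open>y - \<theta>\<close> (excluded) to \<open>y\<close> (included). Its length is less than 1,
  so the indicator is the difference of the two floors.\<close>

lemma beatty_indicator: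
  fixes \<alpha> \<beta> :: real
  assumes "\<alpha> > 1" and "n \<ge> 1"
  defines "\<theta> \<equiv> 1 / \<alpha>"
  shows "(if n \<in> beatty \<alpha> \<beta> then 1 else 0) - \<theta> =
    saw_err K ((\<beta> - real n) * \<theta> - \<theta>) - saw_err K ((\<beta> - real n) * \<theta>) + beatty_poly \<theta> \<beta> K n"
proof -
  define y where "y = (\<beta> - real n) * \<theta>"
  have \<theta>: "0 < \<theta>" "\<theta> < 1" "\<alpha> * \<theta> = 1" using assms(1) by (auto simp: \<theta>_def)
  have iff: "int n = \<lfloor>\<alpha> * of_int m + \<beta>\<rfloor> \<longleftrightarrow> y - \<theta> < of_int (- m) \<and> of_int (- m) \<le> y" for m
  proof -
    have "int n = \<lfloor>\<alpha> * of_int m + \<beta>\<rfloor> \<longleftrightarrow> real n \<le> \<alpha> * of_int m + \<beta> \<and> \<alpha> * of_int m + \<beta> < real n + 1"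
      by (subst eq_commute) (simp add: floor_eq_iff)
    also have "real n \<le> \<alpha> * of_int m + \<beta> \<longleftrightarrow> of_int (- m) \<le> y"
    proof -
      have "y + of_int m = \<theta> * (\<alpha> * of_int m + \<beta> - real n)"
        using \<theta>(3) by (simp add: y_def algebra_simps)
      moreover have "of_int (- m) \<le> y \<longleftrightarrow> 0 \<le> y + of_int m" by auto
      ultimately show ?thesis using \<theta>(1) by (simp add: zero_le_mult_iff)
    qed
    also have "\<alpha> * of_int m + \<beta> < real n + 1 \<longleftrightarrow> y - \<theta> < of_int (- m)"
    proof -
      have "y - \<theta> + of_int m = \<theta> * (\<alpha> * of_int m + \<beta> - real n - 1)"
        using \<theta>(3) by (simp add: y_def algebra_simps)
      moreover have "y - \<theta> < of_int (- m) \<longleftrightarrow> y - \<theta> + of_int m < 0" by auto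
      ultimately show ?thesis using \<theta>(1) by (simp add: mult_less_0_iff) linarith
    qed
    finally show ?thesis by blast
  qed
  have "n \<in> beatty \<alpha> \<beta> \<longleftrightarrow> \<lfloor>y - \<theta>\<rfloor> < \<lfloor>y\<rfloor>"
  proof
    assume "n \<in> beatty \<alpha> \<beta>"
    then obtain m where "y - \<theta> < of_int (- m)" "of_int (- m) \<le> y"
      unfolding beatty_def mem_Collect_eq iff by blast
    hence "\<lfloor>y - \<theta>\<rfloor> < - m" "- m \<le> \<lfloor>y\<rfloor>" by (simp_all only: floor_less_iff le_floor_iff)
    thus "\<lfloor>y - \<theta>\<rfloor> < \<lfloor>y\<rfloor>" by linarith
  next
    assume "\<lfloor>y - \<theta>\<rfloor> < \<lfloor>y\<rfloor>"
    \<comment> \<open>The double negation exhibits \<open>m = - \<lfloor>y\<rfloor>\<close> as the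
      witness required by \<open>iff\<close>.\<close>
    hence "y - \<theta> < of_int (- (- \<lfloor>y\<rfloor>)) \<and> of_int (- (- \<lfloor>y\<rfloor>)) \<le> y" by (simp add: floor_less_iff)
    thus "n \<in> beatty \<alpha> \<beta>"
      unfolding beatty_def mem_Collect_eq iff using assms(2) by blast
  qed
  moreover have "\<lfloor>y - \<theta>\<rfloor> \<le> \<lfloor>y\<rfloor>" "\<lfloor>y\<rfloor> \<le> \<lfloor>y - \<theta>\<rfloor> + 1"
    using \<theta> by linarith+
  ultimately have "(if n \<in> beatty \<alpha> \<beta> then 1 else 0) = real_of_int (\<lfloor>y\<rfloor> - \<lfloor>y - \<theta>\<rfloor>)" by auto
  hence "(if n \<in> beatty \<alpha> \<beta> then 1 else 0) - \<theta> = (frac (y - \<theta>) - 1/2) - (frac y - 1/2)"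
    by (simp add: frac_def)
  thus ?thesis
    unfolding beatty_poly_eq y_def[symmetric] by simp
qed

text \<open>The coefficients \<open>a\<close> and \<open>b\<close> absorb \<beta> and the shift by
  \<theta>, so the frequencies depend on \<theta> alone; this is the source of uniformity in
  \<beta>.\<close>

lemma beatty_poly_cis:
  obtains a b :: "nat \<Rightarrow> complex" where "\<And>k. cmod (a k) \<le> 1" "\<And>k. cmod (b k) \<le> 1"
    "\<And>n. complex_of_real (beatty_poly \<theta> \<beta> K n) =
      (\<Sum>k=1..K. of_real (1 / real k) * (a k * cis (2 * pi * (real n * (real k * \<theta>)))
         + b k * cis (2 * pi * (real n * (- (real k * \<theta>))))))"
proof -
  define u where "u = (\<lambda>k. 2 * pi * real k * (\<beta> * \<theta>))"
  define v where "v = (\<lambda>k. 2 * pi * real k * (\<beta> * \<theta> - \<theta>))"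
  define a where "a = (\<lambda>k. - (cis (- u k) - cis (- v k)) / (2 * pi * \<i>))"
  define b where "b = (\<lambda>k. (cis (u k) - cis (v k)) / (2 * pi * \<i>))"
  have bound: "cmod ((cis x - cis y) / (2 * pi * \<i>)) \<le> 1" for x y
  proof -
    have "cmod (cis x - cis y) \<le> 2"
      using norm_triangle_ineq4[of "cis x" "cis y"] by simp
    also have "2 \<le> 2 * pi" using pi_gt3 by linarith
    finally show ?thesis by (simp add: norm_divide norm_mult)
  qed
  have a: "cmod (a k) \<le> 1" for k
    using bound[of "- u k" "- v k"] by (simp only: a_def norm_minus_cancel minus_divide_left[symmetric])
  have b: "cmod (b k) \<le> 1" for k unfolding b_def by (rule bound)
  have sin_cis: "complex_of_real (sin x) = (cis x - cis (- x)) / (2 * \<i>)" for x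
    by (simp add: complex_eq_iff Re_divide Im_divide)
  have "complex_of_real ((sin (2 * pi * real k * ((\<beta> - real n) * \<theta>))
     - sin (2 * pi * real k * ((\<beta> - real n) * \<theta> - \<theta>))) / (pi * real k)) =
     of_real (1 / real k) * (a k * cis (2 * pi * (real n * (real k * \<theta>)))
         + b k * cis (2 * pi * (real n * (- (real k * \<theta>)))))" for k n
  proof -
    define w where "w = 2 * pi * (real n * (real k * \<theta>))"
    have 1: "2 * pi * real k * ((\<beta> - real n) * \<theta>) = u k - w"
      "2 * pi * real k * ((\<beta> - real n) * \<theta> - \<theta>) = v k - w"
      "2 * pi * (real n * (- (real k * \<theta>))) = - w"
      by (simp_all add: u_def v_def w_def algebra_simps)
    have 2: "cis (u k - w) = cis (u k) * cis (- w)" "cis (v k - w) = cis (v k) * cis (- w)"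
      "cis (- (u k - w)) = cis (- u k) * cis w" "cis (- (v k - w)) = cis (- v k) * cis w"
      by (simp_all add: cis_mult)
    have "complex_of_real ((sin (u k - w) - sin (v k - w)) / (pi * real k)) =
        (of_real (sin (u k - w)) - of_real (sin (v k - w))) / (of_real pi * of_nat k)" by simp
    also have "\<dots> = ((cis (u k) * cis (- w) - cis (- u k) * cis w)
        - (cis (v k) * cis (- w) - cis (- v k) * cis w)) / (2 * \<i>) / (of_real pi * of_nat k)"
      unfolding sin_cis 2 by (simp only: diff_divide_distrib)
    also have "\<dots> = of_real (1 / real k) * (a k * cis w + b k * cis (- w))"
      unfolding a_def b_def by (cases "k = 0") (simp_all add: field_simps)
    finally show ?thesis unfolding 1 w_def[symmetric] .
  qed
  hence "complex_of_real (beatty_poly \<theta> \<beta> K n) =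
      (\<Sum>k=1..K. of_real (1 / real k) * (a k * cis (2 * pi * (real n * (real k * \<theta>)))
         + b k * cis (2 * pi * (real n * (- (real k * \<theta>))))))" for n
    unfolding beatty_poly_def of_real_sum by (intro sum.cong refl)
  with a b show ?thesis by (rule that)
qed

section \<open>Truncation error and sums over frequencies\<close>

text \<open>The rotation estimate with the two sawtooth bounds: the square is at most 4 everywhere,
  and at most \<open>1 / (K * \<delta>)\<^sup>2\<close> at distance \<open>\<delta> / 2\<close> or
  more from the integers.\<close>

lemma sum_saw_err_power2_le:
  assumes sep: "\<And>h. 1 \<le> h \<Longrightarrow> h < L \<Longrightarrow> \<delta> \<le> dist_nint (real h * \<theta>)"
    and "L \<ge> 1" and "\<delta> > 0" and "K \<ge> 1"
  shows "(\<Sum>n=1..N. (saw_err K (y - real n * \<theta>))\<^sup>2) \<le> 4 * (real N / real L + 1) + real N / (real K * \<delta>)\<^sup>2"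
proof -
  have "(\<Sum>n\<in>{0<..0 + N}. (saw_err K (y - real n * \<theta>))\<^sup>2)
      \<le> 4 * (real N / real L + 1) + real N * (1 / (real K * \<delta>)\<^sup>2)"
  proof (rule sum_rotation_le[where \<omega> = "- \<theta>" and y = y and \<delta> = \<delta>])
    fix h assume "1 \<le> h" "h < L"
    thus "\<delta> \<le> dist_nint (real h * - \<theta>)" using sep[of h] by (simp add: dist_nint_minus)
  next
    fix n
    have "\<bar>saw_err K (y - real n * \<theta>)\<bar>\<^sup>2 \<le> 2\<^sup>2"
      by (intro power_mono saw_err_le) auto
    thus "(saw_err K (y - real n * \<theta>))\<^sup>2 \<le> 4" by simp
  next
    fix n assume "\<delta> / 2 \<le> dist_nint (y + real n * - \<theta>)"
    hence d: "\<delta> / 2 \<le> dist_nint (y - real n * \<theta>)" by simp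
    have "\<bar>saw_err K (y - real n * \<theta>)\<bar> \<le> 1 / ((2 * real K + 1) * dist_nint (y - real n * \<theta>))"
      using d \<open>\<delta> > 0\<close> by (intro saw_err_le) auto
    also have "\<dots> \<le> 1 / (real K * \<delta>)"
    proof -
      have "(2 * real K) * (\<delta> / 2) \<le> (2 * real K + 1) * dist_nint (y - real n * \<theta>)"
        using d \<open>\<delta> > 0\<close> by (intro mult_mono) auto
      thus ?thesis using \<open>\<delta> > 0\<close> \<open>K \<ge> 1\<close> by (intro frac_le) auto
    qed
    finally have "\<bar>saw_err K (y - real n * \<theta>)\<bar>\<^sup>2 \<le> (1 / (real K * \<delta>))\<^sup>2"
      by (intro power_mono) auto
    thus "(saw_err K (y - real n * \<theta>))\<^sup>2 \<le> 1 / (real K * \<delta>)\<^sup>2" by (simp add: power_divide)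
  qed (use assms in auto)
  moreover have "{0<..0 + N} = {1..N}" by auto
  ultimately show ?thesis by simp
qed

text \<open>Linearity in \<open>g\<close>: each \<open>k\<close> contributes two frequencies of
  opposite sign with weight \<open>1 / k\<close>. The hypothesis with
  \<open>\<bar>\<omega>\<bar>\<close> covers both signs at once.\<close>

lemma sum_prime_term_cis:
  assumes g: "\<And>n. g n = (\<Sum>k=1..K. of_real (1 / real k) * (a k * cis (2 * pi * (real n * (real k * \<theta>)))
         + b k * cis (2 * pi * (real n * (- (real k * \<theta>))))))"
    and a: "\<And>k. cmod (a k) \<le> 1" and b: "\<And>k. cmod (b k) \<le> 1"
    and S: "\<And>\<omega> k. k \<in> {1..K} \<Longrightarrow> \<bar>\<omega>\<bar> = \<bar>real k * \<theta>\<bar> \<Longrightarrow>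
      cmod (\<Sum>p\<in>I. \<Sum>m\<in>D p. prime_term f (\<lambda>n. cis (2 * pi * (real n * \<omega>))) p m) \<le> B"
  shows "cmod (\<Sum>p\<in>I. \<Sum>m\<in>D p. prime_term f g p m) \<le> 2 * harm K * B"
proof -
  define s where "s = (\<lambda>\<omega>. \<Sum>p\<in>I. \<Sum>m\<in>D p. prime_term f (\<lambda>n. cis (2 * pi * (real n * \<omega>))) p m)"
  define c where "c = (\<lambda>p m. of_real (ln (real p)) * f p * f m)"
  have "(\<Sum>p\<in>I. \<Sum>m\<in>D p. prime_term f g p m) =
      (\<Sum>p\<in>I. \<Sum>m\<in>D p. \<Sum>k=1..K. of_real (1 / real k) *
        (a k * (c p m * cis (2 * pi * (real (p * m) * (real k * \<theta>))))
        + b k * (c p m * cis (2 * pi * (real (p * m) * (- (real k * \<theta>)))))))"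
    unfolding prime_term_def g c_def sum_distrib_left
    by (intro sum.cong refl) (simp add: algebra_simps)
  also have "\<dots> = (\<Sum>p\<in>I. \<Sum>k=1..K. \<Sum>m\<in>D p. of_real (1 / real k) *
        (a k * (c p m * cis (2 * pi * (real (p * m) * (real k * \<theta>))))
        + b k * (c p m * cis (2 * pi * (real (p * m) * (- (real k * \<theta>)))))))"
    by (rule sum.cong[OF refl sum.swap])
  also have "\<dots> = (\<Sum>k=1..K. \<Sum>p\<in>I. \<Sum>m\<in>D p. of_real (1 / real k) *
        (a k * (c p m * cis (2 * pi * (real (p * m) * (real k * \<theta>))))
        + b k * (c p m * cis (2 * pi * (real (p * m) * (- (real k * \<theta>)))))))"
    by (rule sum.swap)
  also have "\<dots> = (\<Sum>k=1..K. of_real (1 / real k) * (a k * s (real k * \<theta>) + b k * s (- (real k * \<theta>))))"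
    unfolding s_def prime_term_def c_def by (simp only: sum.distrib sum_distrib_left[symmetric])
  also have "cmod \<dots> \<le> (\<Sum>k=1..K. 1 / real k * (B + B))"
  proof (rule order_trans[OF norm_sum sum_mono])
    fix k assume k: "k \<in> {1..K}"
    have "cmod (s (real k * \<theta>)) \<le> B" "cmod (s (- (real k * \<theta>))) \<le> B"
      unfolding s_def by (rule S[OF k], simp)+
    hence "cmod (a k) * cmod (s (real k * \<theta>)) \<le> 1 * B" "cmod (b k) * cmod (s (- (real k * \<theta>))) \<le> 1 * B"
      using a[of k] b[of k] by (intro mult_mono; simp)+
    hence "cmod (a k * s (real k * \<theta>) + b k * s (- (real k * \<theta>))) \<le> B + B"
      by (intro norm_triangle_mono) (simp_all add: norm_mult)
    thus "cmod (of_real (1 / real k) * (a k * s (real k * \<theta>) + b k * s (- (real k * \<theta>)))) \<le> 1 / real k * (B + B)"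
      using k by (simp add: norm_mult norm_divide divide_right_mono)
  qed
  also have "\<dots> = 2 * harm K * B"
    by (simp add: harm_def sum_distrib_left sum_distrib_right divide_inverse mult_ac)
  finally show ?thesis .
qed

subsection \<open>Choice of parameters\<close>

text \<open>The exponent 4 makes \<open>1 / sqrt L\<close> at most
  \<open>1 / (ln N)\<^sup>2\<close>, while \<open>ln L\<close> remains of order
  \<open>ln (ln N)\<close>.\<close>

lemma block_length_bounds:
  fixes N :: nat
  assumes "N \<ge> 3"
  defines "L \<equiv> nat \<lceil>(ln (real N)) ^ 4\<rceil>"
  shows "1 \<le> L" "(ln (real N)) ^ 4 \<le> real L" "ln (real L) \<le> 1 + 4 * ln (ln (real N))"
    "real L \<le> 257 * real N" "1 \<le> ln (real N)"
proof -
  have "exp 1 \<le> (3::real)" by (rule exp_le)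
  also have "3 \<le> real N" using assms by simp
  finally show l: "1 \<le> ln (real N)" by (subst ln_ge_iff) (use assms in auto)
  have l4: "1 \<le> (ln (real N)) ^ 4" using l by (rule one_le_power)
  show L: "(ln (real N)) ^ 4 \<le> real L" unfolding L_def by linarith
  show "1 \<le> L" using L l4 by linarith
  have up: "real L \<le> (ln (real N)) ^ 4 + 1" using l4 unfolding L_def by linarith
  have "ln (real L) \<le> ln (2 * (ln (real N)) ^ 4)"
    using up l4 \<open>1 \<le> L\<close> by (subst ln_le_cancel_iff) linarith+
  also have "\<dots> = ln 2 + 4 * ln (ln (real N))"
    using l by (simp add: ln_mult ln_realpow)
  also have "\<dots> \<le> 1 + 4 * ln (ln (real N))" using ln_2_less_1 by simp
  finally show "ln (real L) \<le> 1 + 4 * ln (ln (real N))" .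
  have "(ln (real N)) ^ 4 = ((ln (real N))\<^sup>2)\<^sup>2" by simp
  also have "\<dots> \<le> (16 * sqrt (real N))\<^sup>2"
    using assms by (intro power_mono ln_power2_le) auto
  also have "\<dots> = 256 * real N" by (simp add: power_mult_distrib)
  \<comment> \<open>Squaring \<open>16 * sqrt N\<close> gives \<open>256 * N\<close>, and rounding
    up in \<open>L\<close> adds at most 1.\<close>
  finally show "real L \<le> 257 * real N" using up assms(1) by linarith
qed

text \<open>Counts the dyadic blocks needed: their number is of order \<open>ln N\<close>.\<close>

lemma exists_power2_mult_ge:
  assumes "N \<ge> 3"
  obtains J :: nat where "N \<le> 2 ^ J" "real J \<le> 3 * ln (real N)"
proof -
  define J where "J = nat \<lceil>log 2 (real N)\<rceil>"
  have l: "1 \<le> ln (real N)" using block_length_bounds(5)[OF assms] .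
  have "0 \<le> log 2 (real N)" using assms by simp
  hence J: "log 2 (real N) \<le> real J" "real J \<le> log 2 (real N) + 1" unfolding J_def by linarith+
  have "real N = 2 powr log 2 (real N)" using assms by simp
  also have "\<dots> \<le> 2 powr real J" using J by (intro powr_mono) auto
  also have "\<dots> = real (2 ^ J)" by (simp add: powr_realpow)
  finally have "N \<le> 2 ^ J" by (simp only: of_nat_le_iff)
  moreover have "log 2 (real N) \<le> 2 * ln (real N)"
  proof -
    have "1 / 2 * (2 * ln (real N)) \<le> ln 2 * (2 * ln (real N))"
      using ln2_ge_two_thirds l by (intro mult_right_mono) linarith+
    hence "ln (real N) \<le> 2 * ln (real N) * ln 2" by (simp add: mult_ac)
    thus ?thesis by (simp add: log_def pos_divide_le_eq)
  qed
  ultimately show ?thesis using J l that[of J] by linarith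
qed

text \<open>With \<open>K\<close>, \<open>Q\<close> and \<open>M\<close> all powers of
  \<open>L\<close>, the ranges of small \<open>m\<close> and small \<open>p\<close> cost multiples
  of \<open>N * ln L\<close>. In the remaining range each frequency costs a multiple of
  \<open>N\<close>, and \<open>harm K\<close> is again of order \<open>ln L\<close>.\<close>

lemma sum_beatty_poly_le:
  fixes \<theta> c :: real and t :: nat
  assumes c: "c > 0" and dist: "\<And>k. k \<ge> 1 \<Longrightarrow> c / real k ^ t \<le> dist_nint (real k * \<theta>)"
  shows "\<exists>B0\<ge>0. \<exists>B1\<ge>0. \<forall>A\<ge>1. \<forall>f\<in>FA A. \<forall>\<beta>. \<forall>N\<ge>3.
     ln (real N) * cmod (\<Sum>n=1..N. f n * of_real (beatty_poly \<theta> \<beta> (nat \<lceil>(ln (real N)) ^ 4\<rceil> ^ (t + 1)) n))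
       \<le> A\<^sup>2 * real N * (B0 + B1 * ln (ln (real N)))"
proof -
  obtain C0 where C0: "C0 \<ge> 0"
    "\<And>A f g \<tau> N. A \<ge> 1 \<Longrightarrow> f \<in> FA A \<Longrightarrow> (\<And>n. cmod (g n) \<le> \<tau>) \<Longrightarrow>
     cmod (of_real (ln (real N)) * (\<Sum>n=1..N. f n * g n) - prime_bilinear f g N) \<le> C0 * \<tau> * A\<^sup>2 * real N"
    using ln_times_sum_approx by metis
  \<comment> \<open>As \<open>K = L ^ (t + 1)\<close>, the denominator of \<delta> below is
    \<open>L ^ (t * (t + 2))\<close>; the exponent \<open>s\<close> is larger by 2, so that
    \<open>M * \<delta> = c * L\<^sup>2\<close>.\<close>
  define s where "s = t * (t + 2) + 2"
  define D where "D = sqrt (2 + 2 / c)"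
  define b0 where "b0 = 5 * C0 + 60 + 6 * D"
  define b1 where "b1 = 20 * real s + 5 + 6 * D * (real t + 1)"
  have D: "0 \<le> D" using c by (simp add: D_def)
  have b: "0 \<le> b0" "0 \<le> b1" using C0 D by (auto simp: b0_def b1_def)
  show ?thesis
  \<comment> \<open>The errors add up to \<open>b0 + b1 * ln L\<close>; inserting
    \<open>ln L \<le> 1 + 4 * ln (ln N)\<close> gives these witnesses.\<close>
  proof (rule exI[of _ "b0 + b1"], intro conjI exI[of _ "4 * b1"] allI ballI impI)
    fix A :: real and f \<beta> and N :: nat
    assume A: "1 \<le> A" and f: "f \<in> FA A" and N: "3 \<le> N"
    define L where "L = nat \<lceil>(ln (real N)) ^ 4\<rceil>"
    note L = block_length_bounds[OF N, folded L_def]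
    have pos4: "0 < (ln (real N)) ^ 4" using L(5) by (intro zero_less_power) linarith
    define K where "K = L ^ (t + 1)"
    define M where "M = L ^ s"
    \<comment> \<open>All frequencies \<open>k * \<theta>\<close> with \<open>k \<le> K\<close> must
      be separated at once, so the bound is taken at the largest possible product
      \<open>K * L\<close>.\<close>
    define \<delta> where "\<delta> = c / (real K * real L) ^ t"
    define g where "g = (\<lambda>n. complex_of_real (beatty_poly \<theta> \<beta> K n))"
    have g5: "cmod (g n) \<le> 5" for n unfolding g_def by (simp add: abs_beatty_poly_le)
    have K1: "1 \<le> K" and M1: "1 \<le> M" using L by (auto simp: K_def M_def)
    have \<delta>: "\<delta> > 0" using c L K1 by (simp add: \<delta>_def)
    obtain J where J: "N \<le> 2 ^ J" "real J \<le> 3 * ln (real N)"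
      using exists_power2_mult_ge[OF N] by blast
    have JL: "N \<le> 2 ^ J * L" using J(1) L(1) by (metis le_trans mult_le_mono2 nat_mult_1_right)
    have sep: "\<delta> \<le> dist_nint (real h * \<omega>)"
      if h: "1 \<le> h" "h < L" and k: "k \<in> {1..K}" and \<omega>: "\<bar>\<omega>\<bar> = \<bar>real k * \<theta>\<bar>" for h k \<omega>
    proof -
      have "real (k * h) \<le> real K * real L"
        using h k by (simp add: mult_mono)
      hence "\<delta> \<le> c / real (k * h) ^ t"
        unfolding \<delta>_def using c h k by (intro divide_left_mono power_mono mult_pos_pos zero_less_power) auto
      also have "\<dots> \<le> dist_nint (real (k * h) * \<theta>)" using h k by (intro dist) auto
      also have "\<dots> = dist_nint (real h * \<omega>)"
      proof (cases "\<omega> = real k * \<theta>")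
        case False
        hence "\<omega> = - (real k * \<theta>)" using \<omega> by linarith
        hence "real (k * h) * \<theta> = - (real h * \<omega>)" by simp
        thus ?thesis by (simp only: dist_nint_minus)
      qed (simp add: mult_ac)
      finally show ?thesis .
    qed
    have R: "sqrt (1 / real L + 1 / real L + 2 / (real M * \<delta>)) \<le> D / (ln (real N))\<^sup>2"
    proof -
      have "real M * \<delta> = c * (real L)\<^sup>2"
      proof -
        have "(real K * real L) ^ t = real L ^ (t * (t + 2))"
          by (simp add: K_def power_mult_distrib power_add power_mult power2_eq_square algebra_simps flip: power_mult)
        thus ?thesis using L(1) by (simp add: M_def \<delta>_def s_def power_add power2_eq_square)
      qed
      moreover have "c * real L \<le> c * (real L)\<^sup>2"
        using L(1) c by (simp add: power2_eq_square)
      ultimately have "2 / (real M * \<delta>) \<le> 2 / (c * real L)"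
        using c L(1) by (intro divide_left_mono) auto
      hence "1 / real L + 1 / real L + 2 / (real M * \<delta>) \<le> (2 + 2 / c) / real L"
        by (simp add: add_divide_distrib)
      also have "\<dots> \<le> (2 + 2 / c) / (ln (real N)) ^ 4"
        using c L(2) pos4 by (intro frac_le) auto
      finally have "sqrt (1 / real L + 1 / real L + 2 / (real M * \<delta>)) \<le> sqrt ((2 + 2 / c) / (ln (real N)) ^ 4)"
        by (rule real_sqrt_le_mono)
      also have "\<dots> = D / sqrt (((ln (real N))\<^sup>2)\<^sup>2)" by (simp add: D_def real_sqrt_divide)
      also have "sqrt (((ln (real N))\<^sup>2)\<^sup>2) = (ln (real N))\<^sup>2" by (rule real_sqrt_unique) auto
      finally show ?thesis .
    qed
    have large: "cmod (\<Sum>p | prime p \<and> p \<in> {L<..N}. \<Sum>m\<in>{M<..N div p}. prime_term f g p m)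
        \<le> 2 * harm K * (3 * D * A\<^sup>2 * real N)"
    proof -
      obtain a b where ab: "\<And>k. cmod (a k) \<le> 1" "\<And>k. cmod (b k) \<le> 1"
        "\<And>n. complex_of_real (beatty_poly \<theta> \<beta> K n) =
          (\<Sum>k=1..K. of_real (1 / real k) * (a k * cis (2 * pi * (real n * (real k * \<theta>)))
             + b k * cis (2 * pi * (real n * (- (real k * \<theta>))))))"
        by (rule beatty_poly_cis[where \<theta> = \<theta> and \<beta> = \<beta> and K = K], rule that)
      show ?thesis
      proof (rule sum_prime_term_cis[where a = a and b = b and \<theta> = \<theta>])
        show "g n = (\<Sum>k=1..K. of_real (1 / real k) * (a k * cis (2 * pi * (real n * (real k * \<theta>)))
             + b k * cis (2 * pi * (real n * (- (real k * \<theta>))))))" for n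
          unfolding g_def by (rule ab(3))
      next
        fix \<omega> k assume k: "k \<in> {1..K}" "\<bar>\<omega>\<bar> = \<bar>real k * \<theta>\<bar>"
        have "cmod (\<Sum>p | prime p \<and> p \<in> {L<..N}. \<Sum>m\<in>{M<..N div p}.
              prime_term f (\<lambda>n. cis (2 * pi * (real n * \<omega>))) p m)
            \<le> real J * (A\<^sup>2 * ln (real N) * real N * sqrt (1 / real L + 1 / real L + 2 / (real M * \<delta>)))"
          by (rule norm_prime_large_le[OF sep[OF _ _ k] L(1) \<delta> L(1) M1 f A JL])
        \<comment> \<open>The number of blocks and the prime weight cost one logarithm each;
          \<open>D / (ln N)\<^sup>2\<close> repays both.\<close>
        also have "\<dots> \<le> (3 * ln (real N)) * (A\<^sup>2 * ln (real N) * real N * (D / (ln (real N))\<^sup>2))"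
          using L(5) \<delta> by (intro mult_mono mult_left_mono R J) auto
        also have "\<dots> = 3 * D * A\<^sup>2 * real N"
          using L(5) by (simp add: power2_eq_square)
        finally show "cmod (\<Sum>p | prime p \<and> p \<in> {L<..N}. \<Sum>m\<in>{M<..N div p}.
              prime_term f (\<lambda>n. cis (2 * pi * (real n * \<omega>))) p m) \<le> 3 * D * A\<^sup>2 * real N" .
      qed (rule ab)+
    qed
    have harmK: "harm K \<le> 1 + (real t + 1) * ln (real L)"
      using harm_le[OF K1] L(1) by (simp add: K_def ln_realpow ln_mult algebra_simps)
    define \<Lambda> where "\<Lambda> = ln (real L)"
    have \<Lambda>: "0 \<le> \<Lambda>" using L(1) by (simp add: \<Lambda>_def)
    define X where "X = A\<^sup>2 * real N"
    have X: "0 \<le> X" by (simp add: X_def)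
    have small_m: "cmod (\<Sum>p | prime p \<and> p \<le> N. \<Sum>m | m \<in> {1..M} \<and> p * m \<le> N. prime_term f g p m)
        \<le> X * (40 + 20 * real s * \<Lambda>)"
      using norm_sum_small_m_le[where g = g and N = N, OF f A g5 M1] L(1)
      by (simp add: X_def \<Lambda>_def M_def ln_realpow algebra_simps)
    have small_p: "cmod (\<Sum>p | prime p \<and> p \<le> L. \<Sum>m\<in>{M<..N div p}. prime_term f g p m) \<le> X * (5 * \<Lambda> + 20)"
      using norm_sum_small_p_le[where g = g and M = M and N = N, OF f A g5 L(1)] by (simp add: X_def \<Lambda>_def algebra_simps)
    have "2 * harm K * (3 * D * A\<^sup>2 * real N) = harm K * (6 * D * X)" by (simp add: X_def)
    also have "\<dots> \<le> (1 + (real t + 1) * \<Lambda>) * (6 * D * X)"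
      using harmK D X by (intro mult_right_mono) (auto simp: \<Lambda>_def)
    finally have large': "cmod (\<Sum>p | prime p \<and> p \<in> {L<..N}. \<Sum>m\<in>{M<..N div p}. prime_term f g p m)
        \<le> X * (6 * D + 6 * D * (real t + 1) * \<Lambda>)"
      using large by (simp add: algebra_simps)
    have "cmod (prime_bilinear f g N) \<le> X * (40 + 20 * real s * \<Lambda>) + X * (5 * \<Lambda> + 20)
        + X * (6 * D + 6 * D * (real t + 1) * \<Lambda>)"
      unfolding prime_bilinear_split[where M = M and Q = L]
      by (intro norm_triangle_mono small_m small_p large')
    hence bil: "cmod (prime_bilinear f g N) \<le> X * (b0 - 5 * C0 + b1 * \<Lambda>)"
      by (simp add: b0_def b1_def algebra_simps)
    have "cmod (of_real (ln (real N)) * (\<Sum>n=1..N. f n * g n))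
        \<le> cmod (of_real (ln (real N)) * (\<Sum>n=1..N. f n * g n) - prime_bilinear f g N)
          + cmod (prime_bilinear f g N)"
      using norm_triangle_sub[of _ "prime_bilinear f g N"] by (simp only: add.commute)
    also have "\<dots> \<le> C0 * 5 * A\<^sup>2 * real N + X * (b0 - 5 * C0 + b1 * \<Lambda>)"
      by (intro add_mono C0 A f g5 bil)
    also have "\<dots> = X * (b0 + b1 * \<Lambda>)" by (simp add: X_def algebra_simps)
    also have "\<dots> \<le> X * (b0 + b1 * (1 + 4 * ln (ln (real N))))"
      using X b L(3) by (intro mult_left_mono add_left_mono) (auto simp: \<Lambda>_def)
    finally have "cmod (of_real (ln (real N)) * (\<Sum>n=1..N. f n * g n))
        \<le> X * (b0 + b1 + 4 * b1 * ln (ln (real N)))"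
      by (simp add: algebra_simps)
    thus "ln (real N) * cmod (\<Sum>n=1..N. f n * of_real (beatty_poly \<theta> \<beta> (nat \<lceil>(ln (real N)) ^ 4\<rceil> ^ (t + 1)) n))
       \<le> A\<^sup>2 * real N * (b0 + b1 + 4 * b1 * ln (ln (real N)))"
      using L(5) unfolding norm_mult X_def g_def K_def L_def by simp
  qed (use b in auto)
qed

section \<open>Assembly of the asymptotic formula\<close>

theorem theorem1:
  fixes A \<alpha> :: real
  assumes "A \<ge> 1" and "\<alpha> > 1" and "\<alpha> \<notin> \<rat>" and "finite_type \<alpha>"
  shows "\<exists>C::real. \<forall>(\<beta>::real) (f::nat \<Rightarrow> complex) (N::nat). f \<in> FA A \<longrightarrow> N \<ge> 3 \<longrightarrow>
     cmod ((\<Sum>n\<in>{n\<in>{1..N}. n \<in> beatty \<alpha> \<beta>}. f n)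
           - of_real (1 / \<alpha>) * (\<Sum>n=1..N. f n))
     \<le> C * (real N * ln (ln (real N)) / ln (real N))"
proof -
  \<comment> \<open>These constants, and \<open>B0\<close> and \<open>B1\<close> below, are fixed
    before \<beta>, \<open>f\<close> and \<open>N\<close>, which gives the required
    uniformity.\<close>
  obtain c t where c: "c > 0" and dist: "\<And>k. k \<ge> 1 \<Longrightarrow> c / real k ^ t \<le> dist_nint (real k * (1 / \<alpha>))"
    using finite_type_inverse_bound[OF assms(4,3,2)] by blast
  define \<theta> where "\<theta> = 1 / \<alpha>"
  note dist = dist[folded \<theta>_def]
  obtain B0 B1 where B: "B0 \<ge> 0" "B1 \<ge> 0"
    and poly: "\<forall>A\<ge>1. \<forall>f\<in>FA A. \<forall>\<beta>. \<forall>N\<ge>3. ln (real N) * cmod (\<Sum>n=1..N. f n * of_real (beatty_poly \<theta> \<beta> (nat \<lceil>(ln (real N)) ^ 4\<rceil> ^ (t + 1)) n))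
       \<le> A\<^sup>2 * real N * (B0 + B1 * ln (ln (real N)))"
    using sum_beatty_poly_le[OF c dist] by blast
  \<comment> \<open>Here 1032 is \<open>4 + 4 * 257\<close>, from the near points with
    \<open>L \<le> 257 * N\<close>; the far points give \<open>1 / c\<^sup>2\<close>.\<close>
  define W where "W = 1032 + 1 / c\<^sup>2"
  have W: "0 \<le> W" by (simp add: W_def)
  \<comment> \<open>For \<open>N \<ge> 3\<close> the iterated logarithm is at least this positive
    constant, so errors of size \<open>N / ln N\<close> can be absorbed.\<close>
  define l3 where "l3 = ln (ln (3::real))"
  have "1 < ln (3::real)"
  proof -
    have "exp 1 < (3::real)" using e_less_272 by simp
    hence "ln (exp 1) < ln (3::real)" by (subst ln_less_cancel_iff) auto
    thus ?thesis by simp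
  qed
  hence l3: "0 < l3" by (simp add: l3_def)
  have main: "cmod ((\<Sum>n\<in>{n\<in>{1..N}. n \<in> beatty \<alpha> \<beta>}. f n) - of_real (1 / \<alpha>) * (\<Sum>n=1..N. f n))
      \<le> (A\<^sup>2 * (B0 / l3 + B1) + 2 * A * sqrt W / l3) * (real N * ln (ln (real N)) / ln (real N))"
    if f: "f \<in> FA A" and N: "N \<ge> 3" for f \<beta> N
  proof -
    define L where "L = nat \<lceil>(ln (real N)) ^ 4\<rceil>"
    note L = block_length_bounds[OF N, folded L_def]
    have pos4: "0 < (ln (real N)) ^ 4" using L(5) by (intro zero_less_power) linarith
    define K where "K = L ^ (t + 1)"
    \<comment> \<open>The truncation error involves only the rotation by \<theta> itself, so
      separation is needed for multipliers below \<open>L\<close> only; the choice of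
      \<open>K\<close> then gives \<open>K * \<delta> = c * L\<close>.\<close>
    define \<delta> where "\<delta> = c / real L ^ t"
    define y where "y = (\<lambda>n. (\<beta> - real n) * \<theta>)"
    define \<mu> where "\<mu> = ln (ln (real N))"
    have K1: "1 \<le> K" using L by (simp add: K_def)
    have \<delta>: "0 < \<delta>" using c L by (simp add: \<delta>_def)
    have "ln 3 \<le> ln (real N)" using N by simp
    hence "l3 \<le> \<mu>" using \<open>1 < ln 3\<close> unfolding l3_def \<mu>_def by (subst ln_le_cancel_iff) linarith+
    hence \<mu>: "1 \<le> \<mu> / l3" using l3 by simp
    have sep: "\<delta> \<le> dist_nint (real h * \<theta>)" if "1 \<le> h" "h < L" for h
    proof -
      have "\<delta> \<le> c / real h ^ t"
        unfolding \<delta>_def using that c by (intro divide_left_mono power_mono) auto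
      also have "\<dots> \<le> dist_nint (real h * \<theta>)" by (rule dist) (use that in simp)
      finally show ?thesis .
    qed
    have err2: "(\<Sum>n=1..N. (saw_err K (x - real n * \<theta>))\<^sup>2) \<le> W * real N / (ln (real N)) ^ 4" for x
    proof -
      have "real K * \<delta> = c * real L" using L(1) by (simp add: K_def \<delta>_def)
      hence "(\<Sum>n=1..N. (saw_err K (x - real n * \<theta>))\<^sup>2)
          \<le> 4 * (real N / real L + 1) + real N / (c * real L)\<^sup>2"
        using sum_saw_err_power2_le[OF sep L(1) \<delta> K1, where N = N and y = x] by simp
      also have "\<dots> \<le> 4 * (real N / real L + 257 * real N / real L) + real N / (c\<^sup>2 * real L)"
      proof (intro add_mono mult_left_mono)
        show "1 \<le> 257 * real N / real L" using L by simp
        have "c\<^sup>2 * real L \<le> (c * real L)\<^sup>2"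
          using L(1) c mult_left_mono[of 1 "real L" "c\<^sup>2 * real L"]
          by (simp add: power_mult_distrib power2_eq_square mult_ac)
        thus "real N / (c * real L)\<^sup>2 \<le> real N / (c\<^sup>2 * real L)"
          using c L(1) by (intro divide_left_mono) auto
      qed auto
      also have "\<dots> = W * real N / real L" using c L(1) by (simp add: W_def field_simps)
      also have "\<dots> \<le> W * real N / (ln (real N)) ^ 4"
        using W L(2) pos4 by (intro frac_le) auto
      finally show ?thesis .
    qed
    have err: "(\<Sum>n=1..N. cmod (f n) * \<bar>saw_err K (x - real n * \<theta>)\<bar>) \<le> A * sqrt W * real N / ln (real N)" for x
    proof -
      have "(\<Sum>n=1..N. cmod (f n) * \<bar>saw_err K (x - real n * \<theta>)\<bar>)
          \<le> A * sqrt (real N * (W * real N / (ln (real N)) ^ 4))"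
        by (rule FA_cauchy[OF f]) (use assms(1) err2[of x] in auto)
      also have "real N * (W * real N / (ln (real N)) ^ 4) = W * (real N / (ln (real N))\<^sup>2)\<^sup>2"
        by (simp add: power_divide power2_eq_square power4_eq_xxxx mult_ac)
      also have "sqrt \<dots> = sqrt W * (real N / (ln (real N))\<^sup>2)"
        by (simp add: real_sqrt_mult)
      \<comment> \<open>One of the two logarithms saved is given up, since the other errors are not
        smaller.\<close>
      also have "\<dots> \<le> sqrt W * (real N / ln (real N))"
        using L(5) W by (intro mult_left_mono divide_left_mono) (auto simp: power2_eq_square)
      finally show ?thesis using assms(1) by (simp add: mult_left_mono mult.assoc)
    qed
    have "(\<Sum>n\<in>{n\<in>{1..N}. n \<in> beatty \<alpha> \<beta>}. f n) - of_real (1 / \<alpha>) * (\<Sum>n=1..N. f n)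
        = (\<Sum>n=1..N. f n * of_real ((if n \<in> beatty \<alpha> \<beta> then 1 else 0) - \<theta>))"
    proof -
      have "(\<Sum>n\<in>{n\<in>{1..N}. n \<in> beatty \<alpha> \<beta>}. f n) = (\<Sum>n=1..N. if n \<in> beatty \<alpha> \<beta> then f n else 0)"
        by (rule sum.inter_filter) simp
      thus ?thesis
        unfolding \<theta>_def sum_distrib_left
        by (simp only: sum_subtractf[symmetric]) (auto intro!: sum.cong simp: algebra_simps)
    qed
    also have "\<dots> = (\<Sum>n=1..N. f n * of_real (saw_err K (\<beta> * \<theta> - \<theta> - real n * \<theta>) - saw_err K (\<beta> * \<theta> - real n * \<theta>)))
        + (\<Sum>n=1..N. f n * of_real (beatty_poly \<theta> \<beta> K n))"
      unfolding sum.distrib[symmetric]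
    proof (rule sum.cong[OF refl])
      fix n assume "n \<in> {1..N}"
      hence "(if n \<in> beatty \<alpha> \<beta> then 1 else 0) - \<theta> =
          (saw_err K (\<beta> * \<theta> - \<theta> - real n * \<theta>) - saw_err K (\<beta> * \<theta> - real n * \<theta>)) + beatty_poly \<theta> \<beta> K n"
        using beatty_indicator[OF assms(2), of n \<beta> K] by (simp add: \<theta>_def[symmetric] algebra_simps)
      thus "f n * of_real ((if n \<in> beatty \<alpha> \<beta> then 1 else 0) - \<theta>) =
          f n * of_real (saw_err K (\<beta> * \<theta> - \<theta> - real n * \<theta>) - saw_err K (\<beta> * \<theta> - real n * \<theta>))
          + f n * of_real (beatty_poly \<theta> \<beta> K n)"
        by (simp only: of_real_add distrib_left)
    qed
    also have "cmod \<dots> \<le> (A * sqrt W * real N / ln (real N) + A * sqrt W * real N / ln (real N))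
        + A\<^sup>2 * real N * (B0 + B1 * \<mu>) / ln (real N)"
    proof (rule norm_triangle_mono)
      have "cmod (\<Sum>n=1..N. f n * of_real (saw_err K (\<beta> * \<theta> - \<theta> - real n * \<theta>) - saw_err K (\<beta> * \<theta> - real n * \<theta>)))
          \<le> (\<Sum>n=1..N. cmod (f n) * \<bar>saw_err K (\<beta> * \<theta> - \<theta> - real n * \<theta>)\<bar>
              + cmod (f n) * \<bar>saw_err K (\<beta> * \<theta> - real n * \<theta>)\<bar>)"
      proof (rule order_trans[OF norm_sum sum_mono])
        fix n
        have "\<bar>u - v\<bar> \<le> \<bar>u\<bar> + \<bar>v\<bar>" for u v :: real by simp
        thus "cmod (f n * of_real (saw_err K (\<beta> * \<theta> - \<theta> - real n * \<theta>) - saw_err K (\<beta> * \<theta> - real n * \<theta>)))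
          \<le> cmod (f n) * \<bar>saw_err K (\<beta> * \<theta> - \<theta> - real n * \<theta>)\<bar>
              + cmod (f n) * \<bar>saw_err K (\<beta> * \<theta> - real n * \<theta>)\<bar>"
          unfolding norm_mult norm_of_real distrib_left[symmetric] by (intro mult_left_mono) auto
      qed
      also have "\<dots> \<le> A * sqrt W * real N / ln (real N) + A * sqrt W * real N / ln (real N)"
        unfolding sum.distrib by (intro add_mono err)
      finally show "cmod (\<Sum>n=1..N. f n * of_real (saw_err K (\<beta> * \<theta> - \<theta> - real n * \<theta>) - saw_err K (\<beta> * \<theta> - real n * \<theta>)))
          \<le> A * sqrt W * real N / ln (real N) + A * sqrt W * real N / ln (real N)" .
      show "cmod (\<Sum>n=1..N. f n * of_real (beatty_poly \<theta> \<beta> K n)) \<le> A\<^sup>2 * real N * (B0 + B1 * \<mu>) / ln (real N)"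
        using poly[rule_format, OF assms(1) f N, of \<beta>] L(5)
        unfolding K_def L_def \<mu>_def by (subst pos_le_divide_eq) (auto simp: mult.commute)
    qed
    also have "\<dots> = (2 * A * sqrt W * 1 + A\<^sup>2 * (B0 * 1 + B1 * \<mu>)) * (real N / ln (real N))"
      by (simp add: add_divide_distrib algebra_simps)
    \<comment> \<open>The terms without \<mu> are multiplied by \<open>\<mu> / l3\<close>, which is
      at least 1.\<close>
    also have "\<dots> \<le> (2 * A * sqrt W * (\<mu> / l3) + A\<^sup>2 * (B0 * (\<mu> / l3) + B1 * \<mu>)) * (real N / ln (real N))"
      using \<mu> W B assms(1) L(5) by (intro mult_right_mono add_mono mult_left_mono order_refl) auto
    also have "\<dots> = (A\<^sup>2 * (B0 / l3 + B1) + 2 * A * sqrt W / l3) * (real N * \<mu> / ln (real N))"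
      by (simp add: add_divide_distrib algebra_simps)
    finally show ?thesis unfolding \<mu>_def .
  qed
  show ?thesis
    by (rule exI[of _ "A\<^sup>2 * (B0 / l3 + B1) + 2 * A * sqrt W / l3"]) (use main in blast)
qed

end
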